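(* Let $r(\cdot)\in\mathcal{P}([0,1])$ with $r^{+}<\infty$ and $\lambda(\Omega_1)=0$, where $\Omega_1=r^{-1}(\{1\})$. Let $\varphi:[0,1]\to[0,1]$ be a non-singular map such that $T_\varphi:f\mapsto f\circ\varphi$ maps $L^{r(\cdot)}([0,1])$ into $L^{r_\varphi(\cdot)}([0,1])$, where $r_\varphi(\cdot)=r(\varphi(\cdot))$. Then the following properties hold: (w.1) $T_\varphi$ maps relatively weakly compact subsets of $L^{r(\cdot)}([0,1])$ into relatively weakly compact subsets of $L^{r_\varphi(\cdot)}([0,1])$. (w.2) Let $v_\varphi(\cdot)=u_\varphi(\cdot)^{1/r(\cdot)}$. The operator $T_\varphi:L^{r(\cdot)}([0,1])\to L^{r_\varphi(\cdot)}([0,1])$ is weakly compact if and only if the multiplication operator $M_{v_\varphi}:L^{r(\cdot)}([0,1])\to L^{r(\cdot)}([0,1])$, $M_{v_\varphi}f=v_\varphi f$, is weakly compact. (w.3) Let $r^{-}=1$. If $$M:=\inf_{z\in[0,1]\setminus\Omega_1}u_\varphi(z)>0,$$ then the operator $T_\varphi:L^{r(\cdot)}([0,1])\to L^{r_\varphi(\cdot)}([0,1])$ is not weakly compact.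
   Context: $\lambda$ is Lebesgue measure on $[0,1]$. $\mathcal{P}([0,1])$ is the set of Borel measurable functions $r:[0,1]\to[1,\infty)$; $r^{+}=\operatorname{ess\,sup}r$, $r^{-}=\operatorname{ess\,inf}r$. $L^{r(\cdot)}([0,1])$ is the set of measurable $f$ on $[0,1]$ such that $\rho(f/\eta)<\infty$ for some $\eta>0$, where $\rho(f)=\int_0^1|f(x)|^{r(x)}\,dx$; it is a Banach space with norm $\|f\|_{r(\cdot)}=\inf\{\eta>0:\rho(f/\eta)\le1\}$. A Borel measurable map $\varphi$ is non-singular if $\lambda(\varphi^{-1}(E))=0$ for every Borel $E$ with $\lambda(E)=0$; then $u_\varphi\ge0$ denotes the Radon–Nikodym derivative of $\lambda\circ\varphi^{-1}$ with respect to $\lambda$, i.e. $\lambda(\varphi^{-1}(E))=\int_E u_\varphi\,d\lambda$ for all Borel $E\subset[0,1]$. An operator is weakly compact if it maps the closed unit ball to a relatively weakly compact set. *)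

theory Defs
  imports "HOL-Probability.Essential_Supremum"
begin

text \<open>
  The spaces depend on a parameter (the exponent), so they are not types: a normed space is given by
  a subspace \<open>V\<close> of some real vector space together with a norm \<open>N\<close> on \<open>V\<close>. Only the values on \<open>V\<close>
  of the functionals below are relevant.
\<close>

definition dual_functionals :: "'a::real_vector set \<Rightarrow> ('a \<Rightarrow> real) \<Rightarrow> ('a \<Rightarrow> real) set" where
  "dual_functionals V N =
    {l. (\<forall>x\<in>V. \<forall>y\<in>V. l (x + y) = l x + l y) \<and>
        (\<forall>c. \<forall>x\<in>V. l (c *\<^sub>R x) = c * l x) \<and>
        (\<exists>C. \<forall>x\<in>V. \<bar>l x\<bar> \<le> C * N x)}"

definition weak_topology :: "'a::real_vector set \<Rightarrow> ('a \<Rightarrow> real) \<Rightarrow> 'a topology" where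
  "weak_topology V N =
    topology_generated_by {{x \<in> V. l x \<in> U} | l U. l \<in> dual_functionals V N \<and> open U}"

definition relatively_weakly_compact :: "'a::real_vector set \<Rightarrow> ('a \<Rightarrow> real) \<Rightarrow> 'a set \<Rightarrow> bool" where
  "relatively_weakly_compact V N A \<longleftrightarrow>
    A \<subseteq> V \<and> compactin (weak_topology V N) (weak_topology V N closure_of A)"

definition weakly_compact_operator ::
  "'a::real_vector set \<Rightarrow> ('a \<Rightarrow> real) \<Rightarrow> 'b::real_vector set \<Rightarrow> ('b \<Rightarrow> real) \<Rightarrow> ('a \<Rightarrow> 'b) \<Rightarrow> bool" where
  "weakly_compact_operator V N W P T \<longleftrightarrow>
    T ` V \<subseteq> W \<and> relatively_weakly_compact W P (T ` {x \<in> V. N x \<le> 1})"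

lemma topspace_weak_topology [simp]: "topspace (weak_topology V N) = V"
proof -
  have "(\<lambda>_. 0) \<in> dual_functionals V N"
    by (auto simp: dual_functionals_def intro!: exI[of _ 0])
  then have "V \<in> {{x \<in> V. l x \<in> U} | l U. l \<in> dual_functionals V N \<and> open U}"
    by (auto intro!: exI[of _ "\<lambda>_. 0"] exI[of _ UNIV])
  then show ?thesis
    unfolding weak_topology_def topology_generated_by_topspace by auto
qed

definition unit_leb :: "real measure" where
  "unit_leb = restrict_space lborel {0..1}"

lemma space_unit_leb [simp]: "space unit_leb = {0..1}"
  by (simp add: unit_leb_def space_restrict_space)

text \<open>
  All variable exponent spaces are subspaces of the space \<open>L0\<close> of classes of Borel functions.
  Values outside the unit interval are irrelevant, since the space of the measure is \<open>{0..1}\<close>.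
\<close>

quotient_type L0 = "real \<Rightarrow> real" / partial:
  "\<lambda>f g. f \<in> borel_measurable unit_leb \<and> g \<in> borel_measurable unit_leb \<and>
         (AE x in unit_leb. f x = g x)"
proof (rule part_equivpI)
  show "\<exists>f :: real \<Rightarrow> real. f \<in> borel_measurable unit_leb \<and> f \<in> borel_measurable unit_leb \<and>
         (AE x in unit_leb. f x = f x)" by (rule exI[of _ "\<lambda>_. 0 :: real"]) simp
qed (auto intro!: sympI transpI elim: eventually_elim2)

instantiation L0 :: real_vector
begin

lift_definition zero_L0 :: L0 is "\<lambda>_. 0" by simp

lift_definition plus_L0 :: "L0 \<Rightarrow> L0 \<Rightarrow> L0" is "\<lambda>f g x. f x + g x"
  by (auto elim: eventually_elim2)

lift_definition minus_L0 :: "L0 \<Rightarrow> L0 \<Rightarrow> L0" is "\<lambda>f g x. f x - g x"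
  by (auto elim: eventually_elim2)

lift_definition uminus_L0 :: "L0 \<Rightarrow> L0" is "\<lambda>f x. - f x"
  by (auto elim: eventually_mono)

lift_definition scaleR_L0 :: "real \<Rightarrow> L0 \<Rightarrow> L0" is "\<lambda>c f x. c * f x"
  by (auto elim: eventually_mono)

instance
  by standard (transfer; auto simp: algebra_simps)+

end

definition exponents :: "(real \<Rightarrow> real) set" where
  "exponents = {r \<in> borel_measurable unit_leb. \<forall>x\<in>{0..1}. 1 \<le> r x}"

definition essinf :: "'a measure \<Rightarrow> ('a \<Rightarrow> ereal) \<Rightarrow> ereal" where
  "essinf M f = Sup {z. AE x in M. z \<le> f x}"

lift_definition modular :: "(real \<Rightarrow> real) \<Rightarrow> L0 \<Rightarrow> ennreal" is
  "\<lambda>r f. \<integral>\<^sup>+ x. ennreal (\<bar>f x\<bar> powr r x) \<partial>unit_leb"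
  by (auto intro!: nn_integral_cong_AE elim: eventually_mono)

definition Lvar :: "(real \<Rightarrow> real) \<Rightarrow> L0 set" where
  "Lvar r = {f. \<exists>\<eta>>0. modular r ((1 / \<eta>) *\<^sub>R f) < \<infinity>}"

definition lux_norm :: "(real \<Rightarrow> real) \<Rightarrow> L0 \<Rightarrow> real" where
  "lux_norm r f = Inf {\<eta>. 0 < \<eta> \<and> modular r ((1 / \<eta>) *\<^sub>R f) \<le> 1}"

definition nonsingular :: "(real \<Rightarrow> real) \<Rightarrow> bool" where
  "nonsingular \<phi> \<longleftrightarrow> \<phi> \<in> unit_leb \<rightarrow>\<^sub>M unit_leb \<and>
    (\<forall>E\<in>sets unit_leb. emeasure unit_leb E = 0 \<longrightarrow> emeasure unit_leb (\<phi> -` E \<inter> {0..1}) = 0)"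

text \<open>
  \<open>u\<close> is any real-valued version of the Radon-Nikodym derivative, rather than the particular one
  chosen by \<open>RN_deriv\<close>, because the pointwise infimum of \<open>u\<close> depends on the version.
\<close>

definition is_pushforward_density :: "(real \<Rightarrow> real) \<Rightarrow> (real \<Rightarrow> real) \<Rightarrow> bool" where
  "is_pushforward_density \<phi> u \<longleftrightarrow>
    u \<in> borel_measurable unit_leb \<and> (\<forall>x\<in>{0..1}. 0 \<le> u x) \<and>
    (\<forall>E\<in>sets unit_leb.
      emeasure unit_leb (\<phi> -` E \<inter> {0..1}) = (\<integral>\<^sup>+ x\<in>E. ennreal (u x) \<partial>unit_leb))"

lemma AE_nonsingular_comp:
  assumes "nonsingular \<phi>" "f \<in> borel_measurable unit_leb" "g \<in> borel_measurable unit_leb"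
    and eq: "AE x in unit_leb. f x = (g x :: real)"
  shows "AE x in unit_leb. f (\<phi> x) = g (\<phi> x)"
proof -
  note [measurable] = assms(2,3)
  have \<phi>[measurable]: "\<phi> \<in> unit_leb \<rightarrow>\<^sub>M unit_leb"
    using assms(1) by (simp add: nonsingular_def)
  define E where "E = {x \<in> space unit_leb. f x \<noteq> g x}"
  have E[measurable]: "E \<in> sets unit_leb" unfolding E_def by measurable
  have "emeasure unit_leb E = 0"
    using eq E by (simp add: AE_iff_measurable[OF E] E_def)
  then have "emeasure unit_leb (\<phi> -` E \<inter> {0..1}) = 0"
    using assms(1) E by (simp add: nonsingular_def)
  moreover have "\<phi> -` E \<inter> {0..1} \<in> sets unit_leb"
    using measurable_sets[OF \<phi> E] by simp
  ultimately have "\<phi> -` E \<inter> {0..1} \<in> null_sets unit_leb"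
    by (rule null_setsI)
  moreover have "\<phi> x \<in> E" if "x \<in> space unit_leb" "f (\<phi> x) \<noteq> g (\<phi> x)" for x
    using measurable_space[OF \<phi> that(1)] that(2) by (simp add: E_def)
  then have "{x \<in> space unit_leb. \<not> f (\<phi> x) = g (\<phi> x)} \<subseteq> \<phi> -` E \<inter> {0..1}"
    by (simp add: subset_iff)
  ultimately show ?thesis
    by (rule AE_I')
qed

text \<open>
  Composition with \<open>\<phi>\<close> respects almost everywhere equality only for non-singular \<open>\<phi>\<close>, and
  multiplication by \<open>v\<close> preserves measurability only for measurable \<open>v\<close>; the operators are set to
  \<open>0\<close> otherwise.
\<close>

lift_definition comp_op :: "(real \<Rightarrow> real) \<Rightarrow> L0 \<Rightarrow> L0" is
  "\<lambda>\<phi> f. if nonsingular \<phi> then f \<circ> \<phi> else (\<lambda>_. 0)"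
proof -
  fix \<phi> and f g :: "real \<Rightarrow> real"
  assume *: "f \<in> borel_measurable unit_leb \<and> g \<in> borel_measurable unit_leb \<and>
    (AE x in unit_leb. f x = g x)"
  let ?T = "\<lambda>f. if nonsingular \<phi> then f \<circ> \<phi> else (\<lambda>_. 0)"
  show "?T f \<in> borel_measurable unit_leb \<and> ?T g \<in> borel_measurable unit_leb \<and>
    (AE x in unit_leb. ?T f x = ?T g x)"
  proof (cases "nonsingular \<phi>")
    case True
    then have "\<phi> \<in> unit_leb \<rightarrow>\<^sub>M unit_leb" by (simp add: nonsingular_def)
    then show ?thesis
      using True * AE_nonsingular_comp[of \<phi> f g] by (simp add: measurable_comp)
  qed simp
qed

lift_definition mult_op :: "(real \<Rightarrow> real) \<Rightarrow> L0 \<Rightarrow> L0" is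
  "\<lambda>v f. if v \<in> borel_measurable unit_leb then (\<lambda>x. v x * f x) else (\<lambda>_. 0)"
  by (auto elim: eventually_mono)

end

theory Submission
  imports Defs
begin

text \<open>
  Since \<open>\<integral> \<bar>f \<circ> \<phi>\<bar> powr (r \<circ> \<phi>) = \<integral> u * \<bar>f\<bar> powr r = \<integral> \<bar>v * f\<bar> powr r\<close>, composition with \<open>\<phi>\<close> and
  multiplication by \<open>v\<close> have the same modular. As \<open>\<bar>f\<bar> powr r\<close> runs through all nonnegative integrable
  functions, mapping \<open>Lvar r\<close> into \<open>Lvar (r \<circ> \<phi>)\<close> forces \<open>u\<close> to be essentially bounded
  (\<open>density_bounded\<close>), so both operators are bounded. A bounded operator is weakly continuous, and
  the weak topology of the target is Hausdorff because the functionals \<open>f \<mapsto> \<integral> w * f\<close> with bounded \<open>w\<close>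
  separate points; hence images of relatively weakly compact sets are relatively weakly compact.

  For the equivalence, each of the two operators is obtained from the other by following it with a
  bounded operator, so that weak compactness is passed on in both directions without any duality theory.
  In one direction this is \<open>g \<mapsto> (g / v) \<circ> \<phi>\<close>, with \<open>0\<close> where \<open>v\<close> vanishes (\<open>weighted_comp\<close>). In
  the other it is \<open>g \<mapsto> v * h\<close>, where \<open>h \<circ> \<phi>\<close> is the conditional expectation of \<open>g\<close> given \<open>\<phi>\<close>
  (\<open>weighted_cond_exp\<close>). That this is a contraction is Jensen's inequality, which survives the
  variable exponent because \<open>r \<circ> \<phi>\<close> is itself a function of \<open>\<phi>\<close>.

  If \<open>u\<close> is bounded away from \<open>0\<close>, then multiplication by \<open>1 / v\<close> is bounded as well, and weak compactness
  of the composition operator would make the unit ball of \<open>Lvar r\<close> relatively weakly compact. When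
  \<open>r > 1\<close> almost everywhere but \<open>r\<close> is not bounded away from \<open>1\<close>, this fails
  (\<open>unit_ball_not_relatively_weakly_compact\<close>): normalised functions that live on disjoint sets on
  which \<open>r\<close> is closer and closer to \<open>1\<close> behave like the unit vectors of \<open>\<ell>\<^sup>1\<close>. Some functional has
  the same nonzero value on all of them, whereas any weak cluster point of them vanishes.
\<close>

section \<open>The weak topology of a normed space\<close>

definition bounded_linear_between ::
  "'a::real_vector set \<Rightarrow> ('a \<Rightarrow> real) \<Rightarrow> 'b::real_vector set \<Rightarrow> ('b \<Rightarrow> real) \<Rightarrow> ('a \<Rightarrow> 'b) \<Rightarrow> bool" where
  "bounded_linear_between V N W P T \<longleftrightarrow>
    T ` V \<subseteq> W \<and>
    (\<forall>x\<in>V. \<forall>y\<in>V. T (x + y) = T x + T y) \<and>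
    (\<forall>c. \<forall>x\<in>V. T (c *\<^sub>R x) = c *\<^sub>R T x) \<and>
    (\<exists>K\<ge>0. \<forall>x\<in>V. P (T x) \<le> K * N x)"

lemma openin_weak_topology:
  assumes "l \<in> dual_functionals V N" "open U"
  shows "openin (weak_topology V N) {x \<in> V. l x \<in> U}"
  unfolding weak_topology_def by (rule topology_generated_by_Basis) (use assms in blast)

lemma closedin_weak_topology_fiber:
  assumes "l \<in> dual_functionals V N"
  shows "closedin (weak_topology V N) {x \<in> V. l x = c}"
proof -
  have "V - {x \<in> V. l x = c} = {x \<in> V. l x \<in> - {c}}" by auto
  then show ?thesis
    using openin_weak_topology[OF assms, of "- {c}"] by (auto simp: closedin_def)
qed

text \<open>Two disjoint neighbourhoods are the preimages of two disjoint open sets of reals under a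
  functional that separates the points.\<close>

lemma Hausdorff_space_weak_topology:
  assumes "\<And>x y. x \<in> V \<Longrightarrow> y \<in> V \<Longrightarrow> x \<noteq> y \<Longrightarrow> \<exists>l\<in>dual_functionals V N. l x \<noteq> l y"
  shows "Hausdorff_space (weak_topology V N)"
  unfolding Hausdorff_space_def
proof (intro allI impI)
  fix x y assume "x \<in> topspace (weak_topology V N) \<and> y \<in> topspace (weak_topology V N) \<and> x \<noteq> y"
  then have xy: "x \<in> V" "y \<in> V" "x \<noteq> y" by auto
  then obtain l where l: "l \<in> dual_functionals V N" "l x \<noteq> l y" using assms by blast
  obtain A B where AB: "open A" "open B" "l x \<in> A" "l y \<in> B" "A \<inter> B = {}"
    using hausdorff[OF l(2)] by blast
  show "\<exists>A B. openin (weak_topology V N) A \<and> openin (weak_topology V N) B \<and>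
      x \<in> A \<and> y \<in> B \<and> disjnt A B"
    using AB xy openin_weak_topology[OF l(1) AB(1)] openin_weak_topology[OF l(1) AB(2)]
    by (intro exI[of _ "{z \<in> V. l z \<in> A}"] exI[of _ "{z \<in> V. l z \<in> B}"]) (auto simp: disjnt_def)
qed

lemma dual_functionals_comp:
  assumes T: "bounded_linear_between V N W P T" and l: "l \<in> dual_functionals W P"
    and P: "\<And>y. y \<in> W \<Longrightarrow> 0 \<le> P y"
  shows "l \<circ> T \<in> dual_functionals V N"
proof -
  obtain K where K: "K \<ge> 0" "\<And>x. x \<in> V \<Longrightarrow> P (T x) \<le> K * N x"
    using T by (auto simp: bounded_linear_between_def)
  obtain C where C: "\<And>y. y \<in> W \<Longrightarrow> \<bar>l y\<bar> \<le> C * P y"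
    using l unfolding dual_functionals_def by blast
  have TW: "T x \<in> W" if "x \<in> V" for x
    using T that by (auto simp: bounded_linear_between_def)
  have "\<bar>l (T x)\<bar> \<le> (\<bar>C\<bar> * K) * N x" if x: "x \<in> V" for x
  proof -
    have "\<bar>l (T x)\<bar> \<le> C * P (T x)" by (rule C[OF TW[OF x]])
    also have "\<dots> \<le> \<bar>C\<bar> * P (T x)" by (rule mult_right_mono) (use P[OF TW[OF x]] in auto)
    also have "\<dots> \<le> \<bar>C\<bar> * (K * N x)" by (rule mult_left_mono[OF K(2)[OF x]]) simp
    finally show ?thesis by (simp add: mult.assoc)
  qed
  then show ?thesis
    using T l TW unfolding dual_functionals_def bounded_linear_between_def
    by (auto intro!: exI[of _ "\<bar>C\<bar> * K"])
qed

lemma continuous_map_weak_topology: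
  assumes T: "bounded_linear_between V N W P T" and P: "\<And>y. y \<in> W \<Longrightarrow> 0 \<le> P y"
  shows "continuous_map (weak_topology V N) (weak_topology W P) T"
  unfolding weak_topology_def[of W P]
proof (rule continuous_on_generated_topo)
  have TW: "T ` V \<subseteq> W" using T by (simp add: bounded_linear_between_def)
  show "T ` topspace (weak_topology V N) \<subseteq>
      \<Union>{{y \<in> W. l y \<in> U} | l U. l \<in> dual_functionals W P \<and> open U}"
    using TW topspace_weak_topology[of W P]
    unfolding weak_topology_def[of W P] topology_generated_by_topspace by simp
  fix A assume "A \<in> {{y \<in> W. l y \<in> U} | l U. l \<in> dual_functionals W P \<and> open U}"
  then obtain l U where A: "A = {y \<in> W. l y \<in> U}" "l \<in> dual_functionals W P" "open U" by blast
  have "T -` A \<inter> topspace (weak_topology V N) = {x \<in> V. (l \<circ> T) x \<in> U}"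
    using TW A(1) by auto
  then show "openin (weak_topology V N) (T -` A \<inter> topspace (weak_topology V N))"
    using openin_weak_topology[OF dual_functionals_comp[OF T A(2) P] A(3)] by simp
qed

text \<open>The image of the compact closure is compact, hence closed in the Hausdorff target, and so it
  contains the closure of the image.\<close>

lemma relatively_weakly_compact_image:
  assumes T: "bounded_linear_between V N W P T" and P: "\<And>y. y \<in> W \<Longrightarrow> 0 \<le> P y"
    and H: "Hausdorff_space (weak_topology W P)"
    and A: "relatively_weakly_compact V N A"
  shows "relatively_weakly_compact W P (T ` A)"
proof -
  let ?K = "weak_topology V N closure_of A"
  have AV: "A \<subseteq> V" and K: "compactin (weak_topology V N) ?K"
    using A by (auto simp: relatively_weakly_compact_def)
  have c: "compactin (weak_topology W P) (T ` ?K)"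
    by (rule image_compactin[OF K continuous_map_weak_topology[OF T P]])
  have "T ` A \<subseteq> T ` ?K"
    using AV closure_of_subset[of A "weak_topology V N"] by auto
  then have "weak_topology W P closure_of (T ` A) \<subseteq> T ` ?K"
    using compactin_imp_closedin[OF H c] by (rule closure_of_minimal)
  then have "compactin (weak_topology W P) (weak_topology W P closure_of (T ` A))"
    by (rule closed_compactin[OF c]) simp
  then show ?thesis
    using AV T by (auto simp: relatively_weakly_compact_def bounded_linear_between_def)
qed

text \<open>The composition is a separate map \<open>R\<close>, which has to agree with \<open>T \<circ> S\<close> on \<open>V\<close> only.\<close>

lemma weakly_compact_operator_compose:
  assumes S: "weakly_compact_operator V N W P S"
    and T: "bounded_linear_between W P X Q T" and Q: "\<And>y. y \<in> X \<Longrightarrow> 0 \<le> Q y"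
    and H: "Hausdorff_space (weak_topology X Q)"
    and R: "\<And>x. x \<in> V \<Longrightarrow> T (S x) = R x"
  shows "weakly_compact_operator V N X Q R"
proof -
  have img: "R ` B = T ` (S ` B)" if "B \<subseteq> V" for B
    unfolding image_image by (rule image_cong) (use R that in auto)
  then have *: "R ` {x \<in> V. N x \<le> 1} = T ` (S ` {x \<in> V. N x \<le> 1})" by simp
  have "S ` V \<subseteq> W" using S by (simp add: weakly_compact_operator_def)
  moreover have "T ` W \<subseteq> X" using T by (simp add: bounded_linear_between_def)
  ultimately have "R ` V \<subseteq> X" unfolding img[OF order_refl] by blast
  moreover have "relatively_weakly_compact X Q (R ` {x \<in> V. N x \<le> 1})"
    unfolding * by (rule relatively_weakly_compact_image[OF T Q H])
      (use S in \<open>simp_all add: weakly_compact_operator_def\<close>)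
  ultimately show ?thesis by (simp add: weakly_compact_operator_def)
qed

text \<open>Compactness gives a point in the closures of all tails \<open>F n\<close>. A functional that is constant on
  a tail has the same value at that point, since its fibres are weakly closed.\<close>

lemma relatively_weakly_compact_cluster_point:
  assumes A: "relatively_weakly_compact V N A"
    and F: "\<And>n::nat. F n \<noteq> {}" "\<And>n. F n \<subseteq> A" "\<And>m n. m \<le> n \<Longrightarrow> F n \<subseteq> F m"
  obtains x where "x \<in> V"
    and "\<And>l n c. l \<in> dual_functionals V N \<Longrightarrow> \<forall>y\<in>F n. l y = c \<Longrightarrow> l x = c"
proof -
  let ?X = "weak_topology V N"
  let ?K = "?X closure_of A"
  have AV: "A \<subseteq> V" and K: "compactin ?X ?K"
    using A by (auto simp: relatively_weakly_compact_def)
  have "?K \<inter> (\<Inter> (range (\<lambda>n. ?X closure_of F n))) \<noteq> {}"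
  proof -
    have "?K \<inter> \<Inter>\<F> \<noteq> {}"
      if \<F>: "finite \<F>" "\<F> \<subseteq> range (\<lambda>n. ?X closure_of F n)" for \<F>
    proof -
      obtain I where I: "finite I" "\<F> = (\<lambda>n. ?X closure_of F n) ` I"
        using finite_subset_image[OF \<F>] by blast
      define m where "m = Max (insert 0 I)"
      have "F m \<subseteq> F i" if "i \<in> I" for i
        using F(3)[of i m] that I(1) by (simp add: m_def)
      then have "F m \<subseteq> ?X closure_of F i" if "i \<in> I" for i
        using that closure_of_subset[of "F i" ?X] F(2)[of i] AV by auto
      moreover have "F m \<subseteq> ?K"
        using F(2)[of m] closure_of_subset[of A ?X] AV by auto
      ultimately show ?thesis using F(1)[of m] I(2) by blast
    qed
    then show ?thesis
      using K unfolding compactin_fip by (auto simp: )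
  qed
  then obtain x where x: "\<And>n. x \<in> ?X closure_of F n" by auto
  show ?thesis
  proof (rule that)
    show "x \<in> V"
      using x[of 0] closure_of_subset_topspace[of ?X "F 0"] by auto
    fix l n c assume l: "l \<in> dual_functionals V N" and c: "\<forall>y\<in>F n. l y = c"
    have "?X closure_of F n \<subseteq> {y \<in> V. l y = c}"
      by (rule closure_of_minimal[OF _ closedin_weak_topology_fiber[OF l]])
        (use c F(2)[of n] AV in auto)
    then show "l x = c" using x[of n] by auto
  qed
qed

section \<open>Classes of measurable functions and their representatives\<close>

abbreviation fn :: "L0 \<Rightarrow> real \<Rightarrow> real" where "fn \<equiv> rep_L0"

lemma fn_measurable [measurable, simp]: "fn f \<in> borel_measurable unit_leb"
  using Quotient3_rep_reflp[OF Quotient3_L0] by blast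

lemma abs_fn [simp]: "abs_L0 (fn f) = f"
  using Quotient3_abs_rep[OF Quotient3_L0] by blast

lemma fn_eqI: "AE x in unit_leb. fn f x = fn g x \<Longrightarrow> f = g"
  using Quotient3_rel_rep[OF Quotient3_L0, of f g] by simp

lemma fn_abs:
  assumes "h \<in> borel_measurable unit_leb"
  shows "AE x in unit_leb. fn (abs_L0 h) x = h x"
  using Quotient3_rep_abs[OF Quotient3_L0, of h] assms by blast

lemma fn_plus: "AE x in unit_leb. fn (f + g) x = fn f x + fn g x"
proof -
  have "f + g = abs_L0 (\<lambda>x. fn f x + fn g x)"
    by (metis (mono_tags) abs_fn plus_L0.abs_eq fn_measurable AE_I2)
  then show ?thesis using fn_abs[of "\<lambda>x. fn f x + fn g x"] by simp
qed

lemma fn_scaleR: "AE x in unit_leb. fn (c *\<^sub>R f) x = c * fn f x"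
proof -
  have "c *\<^sub>R f = abs_L0 (\<lambda>x. c * fn f x)"
    using scaleR_L0.abs_eq[of "fn f" c] by simp
  then show ?thesis using fn_abs[of "\<lambda>x. c * fn f x"] by simp
qed

lemma modular_fn: "modular r f = (\<integral>\<^sup>+ x. ennreal (\<bar>fn f x\<bar> powr r x) \<partial>unit_leb)"
  using modular.abs_eq[of "fn f" r] by simp

lemma nonsingular_measurable: "nonsingular \<phi> \<Longrightarrow> \<phi> \<in> unit_leb \<rightarrow>\<^sub>M unit_leb"
  by (simp add: nonsingular_def)

lemma fn_comp_op:
  assumes "nonsingular \<phi>"
  shows "AE x in unit_leb. fn (comp_op \<phi> f) x = fn f (\<phi> x)"
proof -
  have "comp_op \<phi> f = abs_L0 (fn f \<circ> \<phi>)"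
    using comp_op.abs_eq[of "fn f" \<phi>] assms by simp
  then show ?thesis
    using fn_abs[of "fn f \<circ> \<phi>"] measurable_comp[OF nonsingular_measurable[OF assms] fn_measurable]
    by simp
qed

lemma fn_mult_op:
  assumes [measurable]: "v \<in> borel_measurable unit_leb"
  shows "AE x in unit_leb. fn (mult_op v f) x = v x * fn f x"
proof -
  have "mult_op v f = abs_L0 (\<lambda>x. v x * fn f x)"
    using mult_op.abs_eq[of "fn f" v] assms by simp
  then show ?thesis using fn_abs[of "\<lambda>x. v x * fn f x"] by simp
qed

text \<open>The exceptional set has to be enlarged to a measurable null set first, because non-singularity
  speaks about measurable sets only.\<close>

lemma AE_nonsingular:
  assumes ns: "nonsingular \<phi>" and P: "AE x in unit_leb. P x"
  shows "AE x in unit_leb. P (\<phi> x)"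
proof -
  have \<phi>: "\<phi> \<in> unit_leb \<rightarrow>\<^sub>M unit_leb" by (rule nonsingular_measurable[OF ns])
  obtain E where E: "{x \<in> space unit_leb. \<not> P x} \<subseteq> E" "emeasure unit_leb E = 0" "E \<in> sets unit_leb"
    using AE_E[OF P] by blast
  have "emeasure unit_leb (\<phi> -` E \<inter> {0..1}) = 0"
    using ns E by (simp add: nonsingular_def)
  moreover have "\<phi> -` E \<inter> {0..1} \<in> sets unit_leb"
    using measurable_sets[OF \<phi> E(3)] by simp
  ultimately have "\<phi> -` E \<inter> {0..1} \<in> null_sets unit_leb" by (rule null_setsI)
  moreover have "{x \<in> space unit_leb. \<not> P (\<phi> x)} \<subseteq> \<phi> -` E \<inter> {0..1}"
  proof
    fix x assume x: "x \<in> {x \<in> space unit_leb. \<not> P (\<phi> x)}"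
    then have "\<phi> x \<in> space unit_leb" by (intro measurable_space[OF \<phi>]) simp
    then have "\<phi> x \<in> E" using x by (intro subsetD[OF E(1)]) simp
    then show "x \<in> \<phi> -` E \<inter> {0..1}" using x by simp
  qed
  ultimately show ?thesis by (rule AE_I')
qed

interpretation leb: finite_measure unit_leb
proof
  have "emeasure unit_leb (space unit_leb) = 1"
    by (simp add: unit_leb_def emeasure_restrict_space space_restrict_space)
  then show "emeasure unit_leb (space unit_leb) \<noteq> \<infinity>" by simp
qed

section \<open>Variable exponent spaces\<close>

lemma exponentsD:
  assumes "r \<in> exponents"
  shows "r \<in> borel_measurable unit_leb" "\<And>x. x \<in> {0..1} \<Longrightarrow> 1 \<le> r x"
  using assms by (auto simp: exponents_def)

lemma exponents_comp:
  assumes "r \<in> exponents" "nonsingular \<phi>"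
  shows "r \<circ> \<phi> \<in> exponents"
proof -
  have \<phi>: "\<phi> \<in> unit_leb \<rightarrow>\<^sub>M unit_leb" by (rule nonsingular_measurable[OF assms(2)])
  then show ?thesis
    using assms(1) measurable_comp[OF \<phi>, of r] measurable_space[OF \<phi>] by (auto simp: exponents_def)
qed

text \<open>Pointwise this is \<open>c powr p \<le> c\<close>, the convexity of \<open>t \<mapsto> t powr p\<close> along rays from the origin.
  It converts any bound on the modular into a bound on the norm.\<close>

lemma modular_scaleR_le:
  assumes r: "r \<in> exponents" and c: "0 \<le> c" "c \<le> 1"
  shows "modular r (c *\<^sub>R f) \<le> ennreal c * modular r f"
proof -
  note [measurable] = exponentsD(1)[OF r]
  have "AE x in unit_leb. x \<in> {0..1}" by (rule AE_I2) simp
  with fn_scaleR[of c f]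
  have "AE x in unit_leb. ennreal (\<bar>fn (c *\<^sub>R f) x\<bar> powr r x) \<le> ennreal c * ennreal (\<bar>fn f x\<bar> powr r x)"
  proof eventually_elim
    fix x assume x: "fn (c *\<^sub>R f) x = c * fn f x" "x \<in> {0..1}"
    have "c powr r x \<le> c"
      using powr_mono'[of 1 "r x" c] c exponentsD(2)[OF r x(2)] by simp
    then have "\<bar>fn (c *\<^sub>R f) x\<bar> powr r x \<le> c * \<bar>fn f x\<bar> powr r x"
      using c by (simp add: x(1) abs_mult powr_mult mult_right_mono)
    then show "ennreal (\<bar>fn (c *\<^sub>R f) x\<bar> powr r x) \<le> ennreal c * ennreal (\<bar>fn f x\<bar> powr r x)"
      using c by (simp add: ennreal_mult[symmetric] ennreal_leI)
  qed
  then have "modular r (c *\<^sub>R f) \<le> (\<integral>\<^sup>+ x. ennreal c * ennreal (\<bar>fn f x\<bar> powr r x) \<partial>unit_leb)"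
    unfolding modular_fn by (rule nn_integral_mono_AE)
  then show ?thesis by (simp add: modular_fn nn_integral_cmult)
qed

definition admissible :: "(real \<Rightarrow> real) \<Rightarrow> L0 \<Rightarrow> real set" where
  "admissible r f = {\<eta>. 0 < \<eta> \<and> modular r ((1 / \<eta>) *\<^sub>R f) \<le> 1}"

lemma lux_norm_admissible: "lux_norm r f = Inf (admissible r f)"
  by (simp add: lux_norm_def admissible_def)

lemma admissible_bdd_below [simp]: "bdd_below (admissible r f)"
  by (rule bdd_belowI[of _ 0]) (auto simp: admissible_def)

lemma modular_finite_imp_admissible:
  assumes r: "r \<in> exponents" and \<eta>: "\<eta> > 0" and m: "modular r ((1 / \<eta>) *\<^sub>R f) < \<infinity>"
  shows "\<eta> * (1 + enn2real (modular r ((1 / \<eta>) *\<^sub>R f))) \<in> admissible r f"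
proof -
  define K where "K = enn2real (modular r ((1 / \<eta>) *\<^sub>R f))"
  have K: "modular r ((1 / \<eta>) *\<^sub>R f) = ennreal K" "K \<ge> 0"
    using m by (simp_all add: K_def less_top)
  have "modular r ((1 / (1 + K)) *\<^sub>R ((1 / \<eta>) *\<^sub>R f)) \<le> ennreal (1 / (1 + K)) * ennreal K"
    using modular_scaleR_le[OF r, of "1 / (1 + K)" "(1 / \<eta>) *\<^sub>R f"] K by simp
  also have "\<dots> \<le> 1"
    using K(2) by (simp add: ennreal_mult[symmetric] ennreal_le_1)
  finally have "modular r ((1 / (\<eta> * (1 + K))) *\<^sub>R f) \<le> 1"
    by (simp add: mult.commute)
  then show ?thesis using \<eta> K(2) by (simp add: admissible_def flip: K_def)
qed

lemma Lvar_iff_admissible: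
  assumes "r \<in> exponents"
  shows "f \<in> Lvar r \<longleftrightarrow> admissible r f \<noteq> {}"
proof
  assume "f \<in> Lvar r"
  then show "admissible r f \<noteq> {}"
    using modular_finite_imp_admissible[OF assms] unfolding Lvar_def by blast
next
  assume "admissible r f \<noteq> {}"
  then obtain \<eta> where "\<eta> > 0" "modular r ((1 / \<eta>) *\<^sub>R f) \<le> 1"
    by (auto simp: admissible_def)
  then show "f \<in> Lvar r"
    unfolding Lvar_def by (auto intro!: exI[of _ \<eta>] elim: le_less_trans)
qed

lemma lux_norm_nonneg: "r \<in> exponents \<Longrightarrow> f \<in> Lvar r \<Longrightarrow> 0 \<le> lux_norm r f"
  unfolding lux_norm_admissible
  by (rule cInf_greatest) (auto simp: Lvar_iff_admissible admissible_def)

lemma modular_finite_imp_Lvar: "modular r f < \<infinity> \<Longrightarrow> f \<in> Lvar r"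
  unfolding Lvar_def by (auto intro!: exI[of _ 1])

lemma lux_norm_le_1: "modular r f \<le> 1 \<Longrightarrow> lux_norm r f \<le> 1"
  unfolding lux_norm_admissible
  by (rule cInf_lower[OF _ admissible_bdd_below]) (simp add: admissible_def)

lemma Lvar_scaleR:
  assumes "f \<in> Lvar r"
  shows "c *\<^sub>R f \<in> Lvar r"
proof (cases "c = 0")
  case True
  have "modular r 0 = 0" by transfer simp
  then show ?thesis using True by (intro modular_finite_imp_Lvar) simp
next
  case False
  obtain \<eta> where \<eta>: "\<eta> > 0" "modular r ((1 / \<eta>) *\<^sub>R f) < \<infinity>"
    using assms by (auto simp: Lvar_def)
  have "modular r ((1 / (\<bar>c\<bar> * \<eta>)) *\<^sub>R c *\<^sub>R f) = modular r ((1 / \<eta>) *\<^sub>R f)"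
  proof -
    have "AE x in unit_leb. \<bar>fn ((1 / (\<bar>c\<bar> * \<eta>)) *\<^sub>R c *\<^sub>R f) x\<bar> = \<bar>fn ((1 / \<eta>) *\<^sub>R f) x\<bar>"
      using fn_scaleR[of "1 / (\<bar>c\<bar> * \<eta>) * c" f] fn_scaleR[of "1 / \<eta>" f]
      by eventually_elim (use False \<eta> in \<open>simp add: abs_mult abs_divide\<close>)
    then show ?thesis unfolding modular_fn
      by (intro nn_integral_cong_AE) (auto elim: eventually_mono)
  qed
  then show ?thesis using \<eta> False unfolding Lvar_def
    by (auto intro!: exI[of _ "\<bar>c\<bar> * \<eta>"])
qed

section \<open>Bounded operators and functionals\<close>

text \<open>Operators are estimated through the modular, which unlike the norm is an integral.\<close>

definition modular_bounded :: "(real \<Rightarrow> real) \<Rightarrow> (real \<Rightarrow> real) \<Rightarrow> (L0 \<Rightarrow> L0) \<Rightarrow> bool" where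
  "modular_bounded r s T \<longleftrightarrow>
    (\<forall>f\<in>Lvar r. \<forall>g\<in>Lvar r. T (f + g) = T f + T g) \<and>
    (\<forall>c. \<forall>f\<in>Lvar r. T (c *\<^sub>R f) = c *\<^sub>R T f) \<and>
    (\<exists>K::real. \<forall>f\<in>Lvar r. modular s (T f) \<le> ennreal K * modular r f)"

text \<open>The norm bound uses \<open>max 1 K\<close> in place of \<open>K\<close>, since contraction by a factor of at most \<open>1\<close> is
  what \<open>modular_scaleR_le\<close> controls.\<close>

lemma modular_bounded_imp_bounded_linear:
  assumes r: "r \<in> exponents" and s: "s \<in> exponents" and T: "modular_bounded r s T"
  shows "bounded_linear_between (Lvar r) (lux_norm r) (Lvar s) (lux_norm s) T"
proof -
  obtain K0 where K0: "\<And>f. f \<in> Lvar r \<Longrightarrow> modular s (T f) \<le> ennreal K0 * modular r f"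
    using T unfolding modular_bounded_def by blast
  define K where "K = max 1 K0"
  have K: "modular s (T f) \<le> ennreal K * modular r f" if "f \<in> Lvar r" for f
    using K0[OF that] by (rule order_trans) (auto simp: K_def intro!: mult_right_mono ennreal_leI)
  have K1: "K \<ge> 1" by (simp add: K_def)
  have adm: "K * \<eta> \<in> admissible s (T f)" if f: "f \<in> Lvar r" and \<eta>: "\<eta> \<in> admissible r f" for f \<eta>
  proof -
    have \<eta>': "\<eta> > 0" "modular r ((1 / \<eta>) *\<^sub>R f) \<le> 1" using \<eta> by (auto simp: admissible_def)
    have "(1 / (K * \<eta>)) *\<^sub>R T f = (1 / K) *\<^sub>R T ((1 / \<eta>) *\<^sub>R f)"
      using T f by (simp add: modular_bounded_def)
    then have "modular s ((1 / (K * \<eta>)) *\<^sub>R T f) \<le> ennreal (1 / K) * modular s (T ((1 / \<eta>) *\<^sub>R f))"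
      using modular_scaleR_le[OF s, of "1 / K"] K1 by simp
    also have "\<dots> \<le> ennreal (1 / K) * (ennreal K * modular r ((1 / \<eta>) *\<^sub>R f))"
      by (rule mult_left_mono[OF K[OF Lvar_scaleR[OF f]]]) simp
    also have "\<dots> \<le> ennreal (1 / K) * (ennreal K * 1)"
      by (intro mult_left_mono \<eta>'(2)) simp_all
    also have "\<dots> = 1" using K1 by (simp add: ennreal_mult[symmetric])
    finally show ?thesis using \<eta>' K1 by (simp add: admissible_def)
  qed
  have "T f \<in> Lvar s" if f: "f \<in> Lvar r" for f
    using adm[OF f] f r s by (auto simp: Lvar_iff_admissible)
  moreover have "lux_norm s (T f) \<le> K * lux_norm r f" if f: "f \<in> Lvar r" for f
  proof -
    have "lux_norm s (T f) / K \<le> lux_norm r f"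
      unfolding lux_norm_admissible[of r]
    proof (rule cInf_greatest)
      show "admissible r f \<noteq> {}" using f r by (simp add: Lvar_iff_admissible)
      fix \<eta> assume "\<eta> \<in> admissible r f"
      then have "lux_norm s (T f) \<le> K * \<eta>"
        unfolding lux_norm_admissible using adm[OF f] by (intro cInf_lower) auto
      then show "lux_norm s (T f) / K \<le> \<eta>" using K1 by (simp add: field_simps)
    qed
    then show ?thesis using K1 by (simp add: field_simps)
  qed
  ultimately show ?thesis
    using T K1 unfolding modular_bounded_def bounded_linear_between_def
    by (auto intro!: exI[of _ K])
qed

text \<open>The functional is bounded on the unit ball because its integrand is dominated by the modular
  and a fixed function; homogeneity does the rest.\<close>

lemma integral_dual_functional:
  assumes r: "r \<in> exponents" and [measurable]: "w \<in> borel_measurable unit_leb"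
    and H: "integrable unit_leb H"
    and dom: "AE x in unit_leb. \<forall>t. \<bar>w x * t\<bar> \<le> \<bar>t\<bar> powr r x + H x"
  shows "\<And>f. f \<in> Lvar r \<Longrightarrow> integrable unit_leb (\<lambda>x. w x * fn f x)"
    and "(\<lambda>f. \<integral>x. w x * fn f x \<partial>unit_leb) \<in> dual_functionals (Lvar r) (lux_norm r)"
proof -
  note [measurable] = exponentsD(1)[OF r] borel_measurable_integrable[OF H]
  let ?l = "\<lambda>f. \<integral>x. w x * fn f x \<partial>unit_leb"
  define C where "C = 1 + (\<integral>x. \<bar>H x\<bar> \<partial>unit_leb)"
  have int1: "integrable unit_leb (\<lambda>x. w x * fn f x) \<and> \<bar>?l f\<bar> \<le> C" if m: "modular r f \<le> 1" for f
  proof -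
    have le1: "(\<integral>\<^sup>+ x. ennreal (\<bar>fn f x\<bar> powr r x) \<partial>unit_leb) \<le> 1" using m by (simp add: modular_fn)
    have i: "integrable unit_leb (\<lambda>x. \<bar>fn f x\<bar> powr r x)"
      by (rule integrableI_nonneg) (use le1 in \<open>auto simp: less_top[symmetric] top_unique\<close>)
    have ile: "(\<integral>x. \<bar>fn f x\<bar> powr r x \<partial>unit_leb) \<le> 1"
      using le1 nn_integral_eq_integral[OF i] by (simp add: ennreal_le_1)
    have d: "AE x in unit_leb. \<bar>w x * fn f x\<bar> \<le> \<bar>fn f x\<bar> powr r x + \<bar>H x\<bar>"
      using dom by eventually_elim (meson abs_ge_self add_left_mono order_trans)
    have i2: "integrable unit_leb (\<lambda>x. \<bar>fn f x\<bar> powr r x + \<bar>H x\<bar>)" using i H by simp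
    have i3: "integrable unit_leb (\<lambda>x. w x * fn f x)"
      by (rule Bochner_Integration.integrable_bound[OF i2]) (use d in \<open>auto elim: eventually_mono\<close>)
    have "\<bar>?l f\<bar> \<le> (\<integral>x. \<bar>w x * fn f x\<bar> \<partial>unit_leb)" by (rule integral_abs_bound)
    also have "\<dots> \<le> (\<integral>x. \<bar>fn f x\<bar> powr r x + \<bar>H x\<bar> \<partial>unit_leb)"
      by (rule integral_mono_AE) (use i3 i2 d in auto)
    also have "\<dots> \<le> C" using i H ile by (simp add: C_def)
    finally show ?thesis using i3 by simp
  qed
  have wscale: "AE x in unit_leb. w x * fn (c *\<^sub>R f) x = c * (w x * fn f x)" for c f
    using fn_scaleR[of c f] by eventually_elim simp
  have lscale: "?l (c *\<^sub>R f) = c * ?l f" for c f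
    using integral_cong_AE[OF _ _ wscale[of c f]] by simp
  have iscale: "integrable unit_leb (\<lambda>x. w x * fn f x)"
    if "c \<noteq> 0" "integrable unit_leb (\<lambda>x. w x * fn (c *\<^sub>R f) x)" for c f
    using that integrable_cong_AE[OF _ _ wscale[of c f]] by simp
  show int: "integrable unit_leb (\<lambda>x. w x * fn f x)" if f: "f \<in> Lvar r" for f
  proof -
    obtain \<eta> where \<eta>: "\<eta> > 0" "modular r ((1 / \<eta>) *\<^sub>R f) \<le> 1"
      using f r by (auto simp: Lvar_iff_admissible admissible_def)
    then show ?thesis using int1[OF \<eta>(2)] iscale[of "1 / \<eta>" f] by simp
  qed
  have "?l (f + g) = ?l f + ?l g" if f: "f \<in> Lvar r" and g: "g \<in> Lvar r" for f g
  proof -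
    have "?l (f + g) = (\<integral>x. w x * fn f x + w x * fn g x \<partial>unit_leb)"
      by (rule integral_cong_AE) (use fn_plus[of f g] in \<open>auto elim!: eventually_mono simp: distrib_left\<close>)
    then show ?thesis using int[OF f] int[OF g] by simp
  qed
  moreover have "\<bar>?l f\<bar> \<le> C * lux_norm r f" if f: "f \<in> Lvar r" for f
  proof -
    have C1: "C \<ge> 1" by (simp add: C_def)
    have "\<bar>?l f\<bar> / C \<le> lux_norm r f"
      unfolding lux_norm_admissible
    proof (rule cInf_greatest)
      show "admissible r f \<noteq> {}" using f r by (simp add: Lvar_iff_admissible)
      fix \<eta> assume "\<eta> \<in> admissible r f"
      then have \<eta>: "\<eta> > 0" "modular r ((1 / \<eta>) *\<^sub>R f) \<le> 1" by (auto simp: admissible_def)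
      have "\<bar>?l f\<bar> / \<eta> = \<bar>?l ((1 / \<eta>) *\<^sub>R f)\<bar>" using \<eta>(1) by (simp only: lscale) (simp add: abs_mult)
      also have "\<dots> \<le> C" using int1[OF \<eta>(2)] by blast
      finally show "\<bar>?l f\<bar> / C \<le> \<eta>" using \<eta>(1) C1 by (simp add: field_simps)
    qed
    then show ?thesis using C1 by (simp add: field_simps)
  qed
  ultimately show "?l \<in> dual_functionals (Lvar r) (lux_norm r)"
    using lscale unfolding dual_functionals_def by blast
qed

lemma abs_le_1_plus_powr:
  assumes "1 \<le> (p::real)"
  shows "\<bar>t\<bar> \<le> \<bar>t\<bar> powr p + 1"
proof (cases "\<bar>t\<bar> \<le> 1")
  case True then show ?thesis using powr_ge_zero[of "\<bar>t\<bar>" p] by linarith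
next
  case False
  then have "\<bar>t\<bar> powr 1 \<le> \<bar>t\<bar> powr p" using assms by (intro powr_mono) auto
  then show ?thesis using False by simp
qed

lemma bounded_weight_dual_functional:
  assumes r: "r \<in> exponents" and w[measurable]: "w \<in> borel_measurable unit_leb"
    and b: "\<And>x. \<bar>w x\<bar> \<le> 1"
  shows "\<And>f. f \<in> Lvar r \<Longrightarrow> integrable unit_leb (\<lambda>x. w x * fn f x)"
    and "(\<lambda>f. \<integral>x. w x * fn f x \<partial>unit_leb) \<in> dual_functionals (Lvar r) (lux_norm r)"
proof -
  have d: "AE x in unit_leb. \<forall>t. \<bar>w x * t\<bar> \<le> \<bar>t\<bar> powr r x + 1"
  proof (rule AE_I2, intro allI)
    fix x t assume x: "x \<in> space unit_leb"
    have "\<bar>w x * t\<bar> \<le> 1 * \<bar>t\<bar>" unfolding abs_mult by (rule mult_right_mono[OF b]) simp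
    also have "\<dots> \<le> \<bar>t\<bar> powr r x + 1"
      using abs_le_1_plus_powr[of "r x" t] exponentsD(2)[OF r] x by simp
    finally show "\<bar>w x * t\<bar> \<le> \<bar>t\<bar> powr r x + 1" .
  qed
  show "\<And>f. f \<in> Lvar r \<Longrightarrow> integrable unit_leb (\<lambda>x. w x * fn f x)"
    and "(\<lambda>f. \<integral>x. w x * fn f x \<partial>unit_leb) \<in> dual_functionals (Lvar r) (lux_norm r)"
    using integral_dual_functional[OF r w _ d] by auto
qed

lemma Lvar_integrable: "r \<in> exponents \<Longrightarrow> f \<in> Lvar r \<Longrightarrow> integrable unit_leb (fn f)"
  using bounded_weight_dual_functional(1)[of r "\<lambda>_. 1" f] by simp

text \<open>The hypothesis says that \<open>\<bar>f - g\<bar>\<close> has integral zero. It is stated with a bounded weight,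
  because integrals against bounded weights are what functionals and test functions provide.\<close>

lemma integral_sgn_eq_imp_AE:
  fixes f g :: "'a \<Rightarrow> real"
  assumes f: "integrable M f" and g: "integrable M g"
    and eq: "(\<integral>x. sgn (f x - g x) * f x \<partial>M) = (\<integral>x. sgn (f x - g x) * g x \<partial>M)"
  shows "AE x in M. f x = g x"
proof -
  have i: "integrable M (\<lambda>x. \<bar>f x - g x\<bar>)" using f g by simp
  have if': "integrable M (\<lambda>x. sgn (f x - g x) * h x)" if h: "integrable M h" for h
    by (rule Bochner_Integration.integrable_bound[OF h])
      (use f g h in \<open>auto simp: abs_mult sgn_if\<close>)
  have "(\<integral>x. \<bar>f x - g x\<bar> \<partial>M) = (\<integral>x. sgn (f x - g x) * f x - sgn (f x - g x) * g x \<partial>M)"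
    by (rule Bochner_Integration.integral_cong) (auto simp: sgn_if)
  also have "\<dots> = 0" using eq if'[OF f] if'[OF g] by simp
  finally have "AE x in M. \<bar>f x - g x\<bar> = 0"
    using integral_nonneg_eq_0_iff_AE[OF i] by simp
  then show ?thesis by eventually_elim simp
qed

lemma Hausdorff_space_Lvar:
  assumes r: "r \<in> exponents"
  shows "Hausdorff_space (weak_topology (Lvar r) (lux_norm r))"
proof (rule Hausdorff_space_weak_topology, rule ccontr)
  fix f g assume fg: "f \<in> Lvar r" "g \<in> Lvar r" "f \<noteq> g"
    and "\<not> (\<exists>l\<in>dual_functionals (Lvar r) (lux_norm r). l f \<noteq> l g)"
  then have no: "\<forall>l\<in>dual_functionals (Lvar r) (lux_norm r). l f = l g" by simp
  let ?l = "\<lambda>h. \<integral>x. sgn (fn f x - fn g x) * fn h x \<partial>unit_leb"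
  have "?l \<in> dual_functionals (Lvar r) (lux_norm r)"
  proof (rule bounded_weight_dual_functional(2)[OF r])
    show "(\<lambda>x. sgn (fn f x - fn g x)) \<in> borel_measurable unit_leb" by measurable
  qed (simp add: abs_sgn_eq)
  from bspec[OF no this] have "?l f = ?l g" by simp
  then have "AE x in unit_leb. fn f x = fn g x"
    by (rule integral_sgn_eq_imp_AE[OF Lvar_integrable[OF r fg(1)] Lvar_integrable[OF r fg(2)]])
  then show False using fn_eqI fg(3) by blast
qed

lemma Lvar_relatively_weakly_compact_image:
  assumes "r \<in> exponents" "s \<in> exponents" "modular_bounded r s T"
    "relatively_weakly_compact (Lvar r) (lux_norm r) A"
  shows "relatively_weakly_compact (Lvar s) (lux_norm s) (T ` A)"
  by (rule relatively_weakly_compact_image[OF modular_bounded_imp_bounded_linear[OF assms(1-3)]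
        lux_norm_nonneg[OF assms(2)] Hausdorff_space_Lvar[OF assms(2)] assms(4)])

lemma Lvar_weakly_compact_compose:
  assumes "s \<in> exponents" "q \<in> exponents" "modular_bounded s q T"
    "weakly_compact_operator (Lvar r) (lux_norm r) (Lvar s) (lux_norm s) S"
    "\<And>f. f \<in> Lvar r \<Longrightarrow> T (S f) = R f"
  shows "weakly_compact_operator (Lvar r) (lux_norm r) (Lvar q) (lux_norm q) R"
  by (rule weakly_compact_operator_compose[OF assms(4)
        modular_bounded_imp_bounded_linear[OF assms(1-3)]
        lux_norm_nonneg[OF assms(2)] Hausdorff_space_Lvar[OF assms(2)] assms(5)])

section \<open>Essential boundedness of the density\<close>

text \<open>A finite modular at one scale is finite at every scale once the exponent is bounded: rescaling
  by \<open>\<eta>\<close> costs a factor of at most \<open>max 1 \<eta> powr R\<close>.\<close>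

lemma Lvar_imp_modular_finite:
  assumes r: "r \<in> exponents" and R: "AE x in unit_leb. r x \<le> R" and f: "f \<in> Lvar r"
  shows "modular r f < \<infinity>"
proof -
  note [measurable] = exponentsD(1)[OF r]
  obtain \<eta> where \<eta>: "\<eta> > 0" "modular r ((1 / \<eta>) *\<^sub>R f) < \<infinity>"
    using f by (auto simp: Lvar_def)
  define c where "c = max 1 \<eta> powr R"
  have "AE x in unit_leb. x \<in> {0..1}" by (rule AE_I2) simp
  with R fn_scaleR[of "1 / \<eta>" f]
  have "AE x in unit_leb. ennreal (\<bar>fn f x\<bar> powr r x)
      \<le> ennreal c * ennreal (\<bar>fn ((1 / \<eta>) *\<^sub>R f) x\<bar> powr r x)"
  proof eventually_elim
    fix x assume x: "r x \<le> R" "fn ((1 / \<eta>) *\<^sub>R f) x = 1 / \<eta> * fn f x" "x \<in> {0..1}"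
    have rx: "1 \<le> r x" by (rule exponentsD(2)[OF r x(3)])
    have "\<bar>fn f x\<bar> = \<eta> * \<bar>1 / \<eta> * fn f x\<bar>" using \<eta>(1) by (simp add: abs_mult)
    then have "\<bar>fn f x\<bar> powr r x = \<eta> powr r x * \<bar>1 / \<eta> * fn f x\<bar> powr r x"
      using \<eta>(1) by (metis abs_ge_zero less_imp_le powr_mult)
    also have "\<eta> powr r x \<le> c"
    proof -
      have "\<eta> powr r x \<le> max 1 \<eta> powr r x" using \<eta>(1) rx by (intro powr_mono2) auto
      also have "\<dots> \<le> c" unfolding c_def using x(1) by (intro powr_mono) auto
      finally show ?thesis .
    qed
    finally show "ennreal (\<bar>fn f x\<bar> powr r x)
        \<le> ennreal c * ennreal (\<bar>fn ((1 / \<eta>) *\<^sub>R f) x\<bar> powr r x)"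
      by (simp add: x(2) ennreal_mult[symmetric] c_def ennreal_leI mult_right_mono)
  qed
  then have "modular r f \<le> (\<integral>\<^sup>+ x. ennreal c * ennreal (\<bar>fn ((1 / \<eta>) *\<^sub>R f) x\<bar> powr r x) \<partial>unit_leb)"
    unfolding modular_fn[of r f] by (rule nn_integral_mono_AE)
  also have "\<dots> = ennreal c * modular r ((1 / \<eta>) *\<^sub>R f)"
    by (simp add: modular_fn nn_integral_cmult)
  also have "\<dots> < \<infinity>" using \<eta>(2) by (simp add: ennreal_mult_less_top)
  finally show ?thesis .
qed

text \<open>If \<open>u\<close> were unbounded, the sets \<open>{u > 4^n}\<close> would have positive measure, and the sum of their
  normalised indicators with weights \<open>2^-n\<close> would be an integrable function whose product
  with \<open>u\<close> has an integral of at least \<open>2^n\<close> for every \<open>n\<close>.\<close>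

lemma (in finite_measure) AE_bounded_of_integrable_products:
  fixes u :: "'a \<Rightarrow> real"
  assumes [measurable]: "u \<in> borel_measurable M"
    and fin: "\<And>g. g \<in> borel_measurable M \<Longrightarrow> (\<And>x. 0 \<le> g x) \<Longrightarrow> (\<integral>\<^sup>+ x. ennreal (g x) \<partial>M) < \<infinity> \<Longrightarrow>
      (\<integral>\<^sup>+ x. ennreal (u x) * ennreal (g x) \<partial>M) < \<infinity>"
  shows "\<exists>K. AE x in M. u x \<le> K"
proof (rule ccontr)
  assume no: "\<nexists>K. AE x in M. u x \<le> K"
  define B where "B n = {x \<in> space M. u x > 4 ^ n}" for n :: nat
  have B[measurable]: "B n \<in> sets M" for n unfolding B_def by measurable
  define m where "m n = measure M (B n)" for n
  have m: "m n > 0" for n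
  proof (rule ccontr)
    assume "\<not> m n > 0"
    then have "measure M (B n) = 0" using measure_nonneg[of M "B n"] by (simp add: m_def)
    then have "B n \<in> null_sets M" by (auto simp: emeasure_eq_measure)
    then have "AE x in M. x \<notin> B n" by (rule AE_not_in)
    then have "AE x in M. u x \<le> 4 ^ n" by (rule AE_mp) (auto simp: B_def)
    then show False using no by blast
  qed
  define c where "c n = (1 / 2) ^ n / m n" for n
  have c: "c n \<ge> 0" for n using m[of n] by (simp add: c_def)
  define G where "G x = (\<Sum>n. ennreal (c n) * indicator (B n) x)" for x
  have [measurable]: "G \<in> borel_measurable M" unfolding G_def by measurable
  have "(\<integral>\<^sup>+ x. G x \<partial>M) = (\<Sum>n. \<integral>\<^sup>+ x. ennreal (c n) * indicator (B n) x \<partial>M)"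
    unfolding G_def by (rule nn_integral_suminf) simp
  also have "\<dots> = (\<Sum>n. ennreal ((1 / 2) ^ n))"
  proof (rule suminf_cong)
    fix n
    have "(\<integral>\<^sup>+ x. ennreal (c n) * indicator (B n) x \<partial>M) = ennreal (c n) * ennreal (m n)"
      by (simp add: nn_integral_cmult emeasure_eq_measure m_def)
    also have "\<dots> = ennreal ((1 / 2) ^ n)"
      using m[of n] c[of n] by (simp add: ennreal_mult[symmetric] c_def)
    finally show "(\<integral>\<^sup>+ x. ennreal (c n) * indicator (B n) x \<partial>M) = ennreal ((1 / 2) ^ n)" .
  qed
  also have "\<dots> = ennreal (\<Sum>n. (1 / 2) ^ n)" by (rule suminf_ennreal2) (auto intro: summable_geometric)
  finally have G: "(\<integral>\<^sup>+ x. G x \<partial>M) < \<infinity>" by simp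
  then have Gfin: "AE x in M. G x < \<infinity>"
    using nn_integral_PInf_AE[of G M] by (auto simp: less_top)
  define g where "g x = enn2real (G x)" for x
  have [measurable]: "g \<in> borel_measurable M" unfolding g_def by measurable
  have gG: "AE x in M. ennreal (g x) = G x"
    using Gfin by eventually_elim (simp add: g_def less_top)
  have "(\<integral>\<^sup>+ x. ennreal (g x) \<partial>M) = (\<integral>\<^sup>+ x. G x \<partial>M)" by (rule nn_integral_cong_AE[OF gG])
  then have "(\<integral>\<^sup>+ x. ennreal (u x) * ennreal (g x) \<partial>M) < \<infinity>"
    using G by (intro fin) (auto simp: g_def)
  moreover have "ennreal (2 ^ n) \<le> (\<integral>\<^sup>+ x. ennreal (u x) * ennreal (g x) \<partial>M)" for n
  proof -
    have "ennreal (2 ^ n) = ennreal (4 ^ n * c n) * ennreal (m n)"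
      using m[of n] c[of n]
      by (simp add: ennreal_mult[symmetric] c_def power_mult_distrib[symmetric] flip: power_divide)
    also have "\<dots> = (\<integral>\<^sup>+ x. ennreal (4 ^ n * c n) * indicator (B n) x \<partial>M)"
      by (simp add: nn_integral_cmult emeasure_eq_measure m_def)
    also have "\<dots> \<le> (\<integral>\<^sup>+ x. ennreal (u x) * ennreal (g x) \<partial>M)"
    proof (rule nn_integral_mono_AE)
      show "AE x in M. ennreal (4 ^ n * c n) * indicator (B n) x \<le> ennreal (u x) * ennreal (g x)"
        using gG
      proof eventually_elim
        fix x assume x: "ennreal (g x) = G x"
        have "ennreal (c n) * indicator (B n) x \<le> G x"
          using sum_le_suminf[of "\<lambda>n. ennreal (c n) * indicator (B n) x" "{n}"]
          by (simp add: G_def del: sum_mult_indicator)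
        then show "ennreal (4 ^ n * c n) * indicator (B n) x \<le> ennreal (u x) * ennreal (g x)"
          unfolding x using c[of n]
          by (cases "x \<in> B n") (auto simp: B_def ennreal_mult intro!: mult_mono ennreal_leI)
      qed
    qed
    finally show ?thesis .
  qed
  ultimately obtain k where k: "\<And>n. ennreal (2 ^ n) \<le> ennreal k" "k \<ge> 0"
    by (metis ennreal_enn2real enn2real_nonneg infinity_ennreal_def)
  then have "2 ^ n \<le> k" for n :: nat using k by (simp add: ennreal_le_iff)
  moreover obtain n where "k < 2 ^ n" using real_arch_pow[of 2 k] by auto
  ultimately show False by (meson not_le)
qed

section \<open>Composition as a change of density\<close>

locale composition_setting =
  fixes r \<phi> u :: "real \<Rightarrow> real" and R :: real
  assumes r: "r \<in> exponents" and R: "AE x in unit_leb. r x \<le> R"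
    and ns: "nonsingular \<phi>" and dens: "is_pushforward_density \<phi> u"
    and maps: "comp_op \<phi> ` Lvar r \<subseteq> Lvar (r \<circ> \<phi>)"
begin

lemma r_measurable [measurable]: "r \<in> borel_measurable unit_leb"
  by (rule exponentsD(1)[OF r])

lemma \<phi>_measurable [measurable]: "\<phi> \<in> unit_leb \<rightarrow>\<^sub>M unit_leb"
  by (rule nonsingular_measurable[OF ns])

lemma u_measurable [measurable]: "u \<in> borel_measurable unit_leb"
  using dens by (simp add: is_pushforward_density_def)

lemma u_nonneg: "x \<in> {0..1} \<Longrightarrow> 0 \<le> u x"
  using dens by (simp add: is_pushforward_density_def)

lemma r_ge_1: "x \<in> {0..1} \<Longrightarrow> 1 \<le> r x"
  by (rule exponentsD(2)[OF r])

lemma comp_exponent: "r \<circ> \<phi> \<in> exponents"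
  by (rule exponents_comp[OF r ns])

lemma AE_unit: "AE x in unit_leb. x \<in> {0..1}"
  by (rule AE_I2) simp

lemma AE_u_nonneg: "AE x in unit_leb. 0 \<le> u x"
  using AE_unit by eventually_elim (rule u_nonneg)

lemma distr_eq_density: "distr unit_leb unit_leb \<phi> = density unit_leb (\<lambda>x. ennreal (u x))"
proof (rule measure_eqI)
  fix E assume E: "E \<in> sets (distr unit_leb unit_leb \<phi>)"
  then show "emeasure (distr unit_leb unit_leb \<phi>) E
      = emeasure (density unit_leb (\<lambda>x. ennreal (u x))) E"
    using dens by (simp add: emeasure_distr emeasure_density is_pushforward_density_def)
qed simp

lemma nn_integral_comp:
  assumes [measurable]: "g \<in> borel_measurable unit_leb"
  shows "(\<integral>\<^sup>+ x. g (\<phi> x) \<partial>unit_leb) = (\<integral>\<^sup>+ x. ennreal (u x) * g x \<partial>unit_leb)"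
proof -
  have "(\<integral>\<^sup>+ x. g (\<phi> x) \<partial>unit_leb) = (\<integral>\<^sup>+ x. g x \<partial>distr unit_leb unit_leb \<phi>)"
    by (simp add: nn_integral_distr)
  then show ?thesis unfolding distr_eq_density by (simp add: nn_integral_density)
qed

lemma integral_comp:
  assumes [measurable]: "g \<in> borel_measurable unit_leb"
  shows "(\<integral>x. g (\<phi> x) \<partial>unit_leb) = (\<integral>x. u x * g x \<partial>unit_leb :: real)"
proof -
  have "(\<integral>x. g (\<phi> x) \<partial>unit_leb) = (\<integral>x. g x \<partial>distr unit_leb unit_leb \<phi>)"
    by (simp add: integral_distr)
  then show ?thesis
    unfolding distr_eq_density by (simp add: integral_density AE_u_nonneg)
qed

lemma integrable_comp_iff:
  fixes g :: "real \<Rightarrow> real"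
  assumes [measurable]: "g \<in> borel_measurable unit_leb"
  shows "integrable unit_leb (\<lambda>x. g (\<phi> x)) \<longleftrightarrow> integrable unit_leb (\<lambda>x. u x * g x)"
proof -
  have "integrable unit_leb (\<lambda>x. g (\<phi> x)) \<longleftrightarrow> integrable (distr unit_leb unit_leb \<phi>) g"
    by (simp add: integrable_distr_eq)
  then show ?thesis
    unfolding distr_eq_density by (simp add: integrable_density AE_u_nonneg)
qed

lemma AE_density_pos: "AE x in unit_leb. 0 < u (\<phi> x)"
proof -
  define E where "E = {x \<in> space unit_leb. u x = 0}"
  have E[measurable]: "E \<in> sets unit_leb" unfolding E_def by measurable
  have "(\<integral>\<^sup>+ x. indicator E (\<phi> x) \<partial>unit_leb) = (\<integral>\<^sup>+ x. ennreal (u x) * indicator E x \<partial>unit_leb)"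
    by (rule nn_integral_comp) measurable
  also have "\<dots> = (\<integral>\<^sup>+ x. 0 \<partial>unit_leb)"
    by (rule nn_integral_cong) (auto simp: indicator_def E_def)
  finally have "(\<integral>\<^sup>+ x. indicator E (\<phi> x) \<partial>unit_leb) = 0" by simp
  moreover have "(\<lambda>x. indicator E (\<phi> x) :: ennreal) \<in> borel_measurable unit_leb" by measurable
  ultimately have "AE x in unit_leb. indicator E (\<phi> x) = (0::ennreal)"
    by (simp add: nn_integral_0_iff_AE)
  with AE_nonsingular[OF ns AE_unit] show ?thesis
  proof eventually_elim
    fix x assume "\<phi> x \<in> {0..1}" "indicator E (\<phi> x) = (0::ennreal)"
    then show "0 < u (\<phi> x)"
      using u_nonneg[of "\<phi> x"] by (simp add: E_def indicator_eq_0_iff)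
  qed
qed

lemma modular_comp_op:
  "modular (r \<circ> \<phi>) (comp_op \<phi> f) = (\<integral>\<^sup>+ x. ennreal (u x) * ennreal (\<bar>fn f x\<bar> powr r x) \<partial>unit_leb)"
proof -
  have "modular (r \<circ> \<phi>) (comp_op \<phi> f) = (\<integral>\<^sup>+ x. ennreal (\<bar>fn f (\<phi> x)\<bar> powr r (\<phi> x)) \<partial>unit_leb)"
    unfolding modular_fn
    by (rule nn_integral_cong_AE) (use fn_comp_op[OF ns, of f] in \<open>auto elim: eventually_mono\<close>)
  also have "\<dots> = (\<integral>\<^sup>+ x. ennreal (u x) * ennreal (\<bar>fn f x\<bar> powr r x) \<partial>unit_leb)"
    by (rule nn_integral_comp) measurable
  finally show ?thesis .
qed

lemma comp_op_plus: "comp_op \<phi> (f + g) = comp_op \<phi> f + comp_op \<phi> g"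
proof (rule fn_eqI)
  show "AE x in unit_leb. fn (comp_op \<phi> (f + g)) x = fn (comp_op \<phi> f + comp_op \<phi> g) x"
    using fn_comp_op[OF ns, of f] fn_comp_op[OF ns, of g] fn_comp_op[OF ns, of "f + g"]
      AE_nonsingular[OF ns fn_plus[of f g]] fn_plus[of "comp_op \<phi> f" "comp_op \<phi> g"]
    by eventually_elim simp
qed

lemma comp_op_scaleR: "comp_op \<phi> (c *\<^sub>R f) = c *\<^sub>R comp_op \<phi> f"
proof (rule fn_eqI)
  show "AE x in unit_leb. fn (comp_op \<phi> (c *\<^sub>R f)) x = fn (c *\<^sub>R comp_op \<phi> f) x"
    using fn_comp_op[OF ns, of f] fn_comp_op[OF ns, of "c *\<^sub>R f"]
      AE_nonsingular[OF ns fn_scaleR[of c f]] fn_scaleR[of c "comp_op \<phi> f"]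
    by eventually_elim simp
qed

text \<open>Every nonnegative integrable \<open>g\<close> equals \<open>\<bar>f\<bar> powr r\<close> for \<open>f = g powr (1 / r)\<close>, so the mapping
  property says that \<open>u\<close> multiplies integrable functions into integrable functions.\<close>

lemma density_bounded: "\<exists>K. AE x in unit_leb. u x \<le> K"
proof (rule leb.AE_bounded_of_integrable_products)
  fix g :: "real \<Rightarrow> real"
  assume [measurable]: "g \<in> borel_measurable unit_leb" and g0: "\<And>x. 0 \<le> g x"
    and g: "(\<integral>\<^sup>+ x. ennreal (g x) \<partial>unit_leb) < \<infinity>"
  define f where "f = abs_L0 (\<lambda>x. g x powr (1 / r x))"
  have "AE x in unit_leb. fn f x = g x powr (1 / r x)"
    unfolding f_def by (rule fn_abs) measurable
  then have f: "AE x in unit_leb. \<bar>fn f x\<bar> powr r x = g x"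
    using AE_unit
  proof eventually_elim
    fix x assume "fn f x = g x powr (1 / r x)" "x \<in> {0..1}"
    then show "\<bar>fn f x\<bar> powr r x = g x" using g0[of x] r_ge_1[of x] by (simp add: powr_powr)
  qed
  have "modular r f = (\<integral>\<^sup>+ x. ennreal (g x) \<partial>unit_leb)"
    unfolding modular_fn by (rule nn_integral_cong_AE) (use f in \<open>auto elim: eventually_mono\<close>)
  then have "comp_op \<phi> f \<in> Lvar (r \<circ> \<phi>)"
    using g maps modular_finite_imp_Lvar[of r f] by auto
  then have "modular (r \<circ> \<phi>) (comp_op \<phi> f) < \<infinity>"
    using Lvar_imp_modular_finite[OF comp_exponent, of R] AE_nonsingular[OF ns R] by simp
  also have "modular (r \<circ> \<phi>) (comp_op \<phi> f) = (\<integral>\<^sup>+ x. ennreal (u x) * ennreal (g x) \<partial>unit_leb)"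
    unfolding modular_comp_op
    by (rule nn_integral_cong_AE) (use f in \<open>auto elim: eventually_mono\<close>)
  finally show "(\<integral>\<^sup>+ x. ennreal (u x) * ennreal (g x) \<partial>unit_leb) < \<infinity>" .
qed simp

lemma modular_bounded_comp_op: "modular_bounded r (r \<circ> \<phi>) (comp_op \<phi>)"
proof -
  obtain K where K: "AE x in unit_leb. u x \<le> K" using density_bounded by blast
  have "modular (r \<circ> \<phi>) (comp_op \<phi> f) \<le> ennreal K * modular r f" for f
  proof -
    have "modular (r \<circ> \<phi>) (comp_op \<phi> f)
        \<le> (\<integral>\<^sup>+ x. ennreal K * ennreal (\<bar>fn f x\<bar> powr r x) \<partial>unit_leb)"
      unfolding modular_comp_op
      by (rule nn_integral_mono_AE)
        (use K in \<open>auto elim!: eventually_mono intro!: mult_right_mono ennreal_leI\<close>)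
    then show ?thesis by (simp add: modular_fn nn_integral_cmult)
  qed
  then show ?thesis unfolding modular_bounded_def using comp_op_plus comp_op_scaleR by blast
qed

end

lemma mult_op_plus:
  assumes v: "v \<in> borel_measurable unit_leb"
  shows "mult_op v (f + g) = mult_op v f + mult_op v g"
proof (rule fn_eqI)
  show "AE x in unit_leb. fn (mult_op v (f + g)) x = fn (mult_op v f + mult_op v g) x"
    using fn_mult_op[OF v, of f] fn_mult_op[OF v, of g] fn_mult_op[OF v, of "f + g"]
      fn_plus[of f g] fn_plus[of "mult_op v f" "mult_op v g"]
    by eventually_elim (simp add: distrib_left)
qed

lemma mult_op_scaleR:
  assumes v: "v \<in> borel_measurable unit_leb"
  shows "mult_op v (c *\<^sub>R f) = c *\<^sub>R mult_op v f"
proof (rule fn_eqI)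
  show "AE x in unit_leb. fn (mult_op v (c *\<^sub>R f)) x = fn (c *\<^sub>R mult_op v f) x"
    using fn_mult_op[OF v, of f] fn_mult_op[OF v, of "c *\<^sub>R f"]
      fn_scaleR[of c f] fn_scaleR[of c "mult_op v f"]
    by eventually_elim simp
qed

lemma modular_mult_op:
  assumes v: "v \<in> borel_measurable unit_leb"
  shows "modular r (mult_op v f)
    = (\<integral>\<^sup>+ x. ennreal (\<bar>v x\<bar> powr r x) * ennreal (\<bar>fn f x\<bar> powr r x) \<partial>unit_leb)"
  unfolding modular_fn
  by (rule nn_integral_cong_AE)
    (use fn_mult_op[OF v, of f] in
      \<open>auto elim!: eventually_mono simp: abs_mult powr_mult ennreal_mult\<close>)

context composition_setting
begin

definition weight :: "real \<Rightarrow> real" where "weight x = u x powr (1 / r x)"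

lemma weight_measurable [measurable]: "weight \<in> borel_measurable unit_leb"
  unfolding weight_def by measurable

lemma weight_powr: "x \<in> {0..1} \<Longrightarrow> \<bar>weight x\<bar> powr r x = u x"
  using u_nonneg[of x] r_ge_1[of x] by (simp add: weight_def powr_powr)

lemma modular_mult_op_weight: "modular r (mult_op weight f) = modular (r \<circ> \<phi>) (comp_op \<phi> f)"
  unfolding modular_mult_op[OF weight_measurable] modular_comp_op
  by (rule nn_integral_cong) (simp add: weight_powr)

lemma mult_op_weight_maps: "mult_op weight ` Lvar r \<subseteq> Lvar r"
proof safe
  fix f assume "f \<in> Lvar r"
  then have "modular (r \<circ> \<phi>) (comp_op \<phi> f) < \<infinity>"
    using Lvar_imp_modular_finite[OF comp_exponent, of R] AE_nonsingular[OF ns R] maps by auto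
  then show "mult_op weight f \<in> Lvar r"
    by (intro modular_finite_imp_Lvar) (simp add: modular_mult_op_weight)
qed

text \<open>The inverse of \<open>weight\<close> where \<open>u > 0\<close>. Where \<open>u = 0\<close> it takes the value \<open>0\<close>, as \<open>0 powr a = 0\<close>.\<close>

definition inv_weight :: "real \<Rightarrow> real" where "inv_weight x = u x powr (- 1 / r x)"

definition weighted_comp :: "L0 \<Rightarrow> L0" where
  "weighted_comp f = comp_op \<phi> (mult_op inv_weight f)"

text \<open>A contraction, as \<open>u * inv_weight powr r\<close> is the indicator function of \<open>{u > 0}\<close>.\<close>

lemma modular_bounded_weighted_comp: "modular_bounded r (r \<circ> \<phi>) weighted_comp"
proof -
  have w: "inv_weight \<in> borel_measurable unit_leb" unfolding inv_weight_def by measurable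
  have "modular (r \<circ> \<phi>) (weighted_comp f) \<le> ennreal 1 * modular r f" for f
  proof -
    have "AE x in unit_leb. ennreal (u x) * ennreal (\<bar>fn (mult_op inv_weight f) x\<bar> powr r x)
        \<le> ennreal (\<bar>fn f x\<bar> powr r x)"
      using AE_unit fn_mult_op[OF w, of f]
    proof eventually_elim
      fix x assume x: "x \<in> {0..1}"
        "fn (mult_op inv_weight f) x = inv_weight x * fn f x"
      have e: "- 1 / r x * r x = - 1" using r_ge_1[OF x(1)] by simp
      have "u x * inv_weight x powr r x \<le> 1"
        unfolding inv_weight_def powr_powr e using u_nonneg[OF x(1)] by (cases "u x = 0") (auto simp: powr_minus)
      then have "u x * inv_weight x powr r x * \<bar>fn f x\<bar> powr r x \<le> 1 * \<bar>fn f x\<bar> powr r x"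
        by (rule mult_right_mono) simp
      then show "ennreal (u x) * ennreal (\<bar>fn (mult_op inv_weight f) x\<bar> powr r x)
          \<le> ennreal (\<bar>fn f x\<bar> powr r x)"
        using u_nonneg[OF x(1)]
        by (simp add: x(2) abs_mult powr_mult ennreal_mult[symmetric] ennreal_leI mult.assoc inv_weight_def)
    qed
    then show ?thesis unfolding weighted_comp_def modular_comp_op by (simp add: modular_fn nn_integral_mono_AE)
  qed
  then show ?thesis
    unfolding modular_bounded_def weighted_comp_def
    using comp_op_plus comp_op_scaleR mult_op_plus[OF w] mult_op_scaleR[OF w] weighted_comp_def by metis
qed

text \<open>The two weights cancel only on \<open>{u > 0}\<close>, but almost every value of \<open>\<phi>\<close> lies there.\<close>

lemma weighted_comp_mult_op: "weighted_comp (mult_op weight f) = comp_op \<phi> f"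
proof -
  have w: "inv_weight \<in> borel_measurable unit_leb" unfolding inv_weight_def by measurable
  let ?g = "mult_op inv_weight (mult_op weight f)"
  have "AE x in unit_leb. 0 < u x \<longrightarrow> fn ?g x = fn f x"
    using fn_mult_op[OF w, of "mult_op weight f"] fn_mult_op[OF weight_measurable, of f]
    by eventually_elim (auto simp: weight_def inv_weight_def powr_add[symmetric])
  from AE_nonsingular[OF ns this]
  have "AE x in unit_leb. fn (comp_op \<phi> ?g) x = fn (comp_op \<phi> f) x"
    using AE_density_pos fn_comp_op[OF ns, of ?g] fn_comp_op[OF ns, of f]
    by eventually_elim simp
  then show ?thesis unfolding weighted_comp_def by (rule fn_eqI)
qed

end

section \<open>Weighted conditional expectation\<close>

text \<open>The graph of \<open>t \<mapsto> \<bar>t\<bar> powr p\<close> lies above its tangent at \<open>a\<close>. Integrated with \<open>b = g\<close> and the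
  conditional expectation of \<open>g\<close> as \<open>a\<close>, it takes the place of Jensen's inequality, in which the
  exponent would have to be constant. After the evaluation of the term with \<open>sgn a * a\<close> it is
  Young's inequality.\<close>

lemma abs_powr_tangent_le:
  fixes a b p :: real
  assumes p: "1 \<le> p"
  shows "\<bar>a\<bar> powr p + p * \<bar>a\<bar> powr (p - 1) * sgn a * (b - a) \<le> \<bar>b\<bar> powr p"
proof (cases "a = 0")
  case False
  have aa: "\<bar>a\<bar> powr (p - 1) * \<bar>a\<bar> = \<bar>a\<bar> powr p"
    using False powr_add[of "\<bar>a\<bar>" "p - 1" 1] by simp
  have "p * (\<bar>b\<bar> * \<bar>a\<bar> powr (p - 1)) \<le> \<bar>b\<bar> powr p + (p - 1) * \<bar>a\<bar> powr p"
  proof (cases "p = 1")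
    case True then show ?thesis using False by simp
  next
    case ne: False
    define q where "q = p / (p - 1)"
    have p1: "p > 1" using ne p by simp
    have q: "q > 1" "1 / p + 1 / q = 1" "(p - 1) * q = p" "1 / q = (p - 1) / p"
      using p1 by (auto simp: q_def field_simps)
    have "\<bar>b\<bar> * \<bar>a\<bar> powr (p - 1) \<le> \<bar>b\<bar> powr p / p + (\<bar>a\<bar> powr (p - 1)) powr q / q"
      by (rule Youngs_inequality) (use p1 q in auto)
    also have "\<dots> = \<bar>b\<bar> powr p / p + \<bar>a\<bar> powr p * (1 / q)"
      by (simp add: powr_powr q(3))
    also have "\<dots> = (\<bar>b\<bar> powr p + (p - 1) * \<bar>a\<bar> powr p) / p"
      unfolding q(4) using p1 by (simp add: field_simps)
    finally show ?thesis using p1 by (simp add: field_simps)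
  qed
  moreover have "sgn a * b \<le> \<bar>b\<bar>" by (auto simp: sgn_if)
  then have "p * \<bar>a\<bar> powr (p - 1) * (sgn a * b) \<le> p * \<bar>a\<bar> powr (p - 1) * \<bar>b\<bar>"
    by (rule mult_left_mono) (use p in simp)
  moreover have "p * \<bar>a\<bar> powr (p - 1) * (sgn a * a) = p * \<bar>a\<bar> powr p"
    unfolding aa[symmetric] by (simp add: abs_sgn[symmetric] mult.commute[of "sgn a"])
  moreover have "p * \<bar>a\<bar> powr (p - 1) * sgn a * (b - a)
      = p * \<bar>a\<bar> powr (p - 1) * (sgn a * b) - p * \<bar>a\<bar> powr (p - 1) * (sgn a * a)"
    by (simp add: algebra_simps)
  moreover have "p * (\<bar>b\<bar> * \<bar>a\<bar> powr (p - 1)) = p * \<bar>a\<bar> powr (p - 1) * \<bar>b\<bar>" by simp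
  moreover have "(p - 1) * \<bar>a\<bar> powr p = p * \<bar>a\<bar> powr p - \<bar>a\<bar> powr p" by (simp add: left_diff_distrib)
  ultimately show ?thesis by linarith
qed simp

context composition_setting
begin

text \<open>The signed measure with density \<open>k\<close> is the image under \<open>\<phi>\<close> of the one with density \<open>g\<close>. Testing
  against bounded functions rather than sets makes uniqueness and linearity immediate.\<close>

definition pushes_to :: "(real \<Rightarrow> real) \<Rightarrow> (real \<Rightarrow> real) \<Rightarrow> bool" where
  "pushes_to g k \<longleftrightarrow> integrable unit_leb g \<and> integrable unit_leb k \<and>
    (\<forall>w\<in>borel_measurable unit_leb. \<forall>B. (\<forall>x. \<bar>w x\<bar> \<le> B) \<longrightarrow>
      (\<integral>x. w (\<phi> x) * g x \<partial>unit_leb) = (\<integral>x. w x * k x \<partial>unit_leb))"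

lemma pushes_toD:
  assumes "pushes_to g k"
  shows "integrable unit_leb g" "integrable unit_leb k"
    "\<And>w B. w \<in> borel_measurable unit_leb \<Longrightarrow> (\<And>x. \<bar>w x\<bar> \<le> B) \<Longrightarrow>
      (\<integral>x. w (\<phi> x) * g x \<partial>unit_leb) = (\<integral>x. w x * k x \<partial>unit_leb)"
  using assms unfolding pushes_to_def by blast+

lemma integrable_bounded_mult:
  fixes w g :: "real \<Rightarrow> real"
  assumes g: "integrable unit_leb g" and [measurable]: "w \<in> borel_measurable unit_leb"
    and B: "\<And>x. \<bar>w x\<bar> \<le> B"
  shows "integrable unit_leb (\<lambda>x. w x * g x)"
proof (rule Bochner_Integration.integrable_bound[of _ "\<lambda>x. B * g x"])
  show "integrable unit_leb (\<lambda>x. B * g x)" using g by simp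
  show "(\<lambda>x. w x * g x) \<in> borel_measurable unit_leb" using borel_measurable_integrable[OF g] by measurable
  have "\<bar>w x\<bar> \<le> \<bar>B\<bar>" for x using B[of x] by simp
  then show "AE x in unit_leb. norm (w x * g x) \<le> norm (B * g x)"
    by (auto simp: abs_mult intro!: mult_right_mono)
qed

text \<open>For nonnegative \<open>g\<close> the image is a finite measure, and it is absolutely continuous because \<open>\<phi>\<close> is
  non-singular; its Radon-Nikodym derivative is the required density.\<close>

lemma pushes_to_nonneg_exists:
  assumes g: "integrable unit_leb g" and g0: "\<And>x. 0 \<le> g x"
  shows "\<exists>k. pushes_to g k"
proof -
  note [measurable] = borel_measurable_integrable[OF g]
  define N where "N = distr (density unit_leb (\<lambda>x. ennreal (g x))) unit_leb \<phi>"
  have \<phi>': "\<phi> \<in> density unit_leb (\<lambda>x. ennreal (g x)) \<rightarrow>\<^sub>M unit_leb" by simp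
  have N: "emeasure N E = (\<integral>\<^sup>+ x\<in>\<phi> -` E \<inter> {0..1}. ennreal (g x) \<partial>unit_leb)"
    if E: "E \<in> sets unit_leb" for E
  proof -
    have "emeasure N E = emeasure (density unit_leb (\<lambda>x. ennreal (g x))) (\<phi> -` E \<inter> {0..1})"
      unfolding N_def by (subst emeasure_distr[OF \<phi>' E]) simp
    also have "\<dots> = (\<integral>\<^sup>+ x\<in>\<phi> -` E \<inter> {0..1}. ennreal (g x) \<partial>unit_leb)"
      by (rule emeasure_density) (use measurable_sets[OF \<phi>_measurable E] in simp_all)
    finally show ?thesis .
  qed
  have sN: "sets N = sets unit_leb" by (simp add: N_def)
  have "finite_measure N"
  proof
    have "space N \<in> sets unit_leb" by (simp flip: sN)
    then have "emeasure N (space N) \<le> (\<integral>\<^sup>+ x. ennreal (g x) \<partial>unit_leb)"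
      by (subst N) (auto intro!: nn_integral_mono simp: indicator_def)
    also have "\<dots> < \<infinity>" using nn_integral_eq_integral[OF g] g0 by simp
    finally show "emeasure N (space N) \<noteq> \<infinity>" by simp
  qed
  moreover have ac: "absolutely_continuous unit_leb N"
    unfolding absolutely_continuous_def
  proof
    fix E assume E: "E \<in> null_sets unit_leb"
    then have "emeasure unit_leb (\<phi> -` E \<inter> {0..1}) = 0" and E': "E \<in> sets unit_leb"
      using ns by (auto simp: nonsingular_def)
    moreover have "\<phi> -` E \<inter> {0..1} \<in> sets unit_leb"
      using measurable_sets[OF \<phi>_measurable E'] by simp
    ultimately have "\<phi> -` E \<inter> {0..1} \<in> null_sets unit_leb" by (intro null_setsI)
    then have "emeasure N E = 0"
      unfolding N[OF E'] by (rule nn_integral_null_set)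
    then show "E \<in> null_sets N" using E' sN by (auto intro: null_setsI)
  qed
  ultimately obtain k where k[measurable]: "k \<in> borel_measurable unit_leb"
    and RN: "AE x in unit_leb. RN_deriv unit_leb N x = ennreal (k x)" and k0: "\<And>x. 0 \<le> k x"
    using leb.real_RN_deriv[OF _ ac sN] by blast
  interpret N: finite_measure N by fact
  have Nk: "N = density unit_leb (\<lambda>x. ennreal (k x))"
    using leb.density_RN_deriv[OF ac sN] density_cong[OF _ _ RN] by simp
  have "integrable N (\<lambda>_. 1 :: real)" by simp
  then have ik: "integrable unit_leb k"
    unfolding Nk using k0 by (simp add: integrable_density)
  show ?thesis
  proof (rule exI[of _ k], unfold pushes_to_def, intro conjI ballI allI impI g ik)
    fix w :: "real \<Rightarrow> real" and B assume w[measurable]: "w \<in> borel_measurable unit_leb"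
    have "(\<integral>x. w x \<partial>N) = (\<integral>x. w (\<phi> x) \<partial>density unit_leb (\<lambda>x. ennreal (g x)))"
      unfolding N_def by (rule integral_distr[OF \<phi>' w])
    also have "\<dots> = (\<integral>x. g x *\<^sub>R w (\<phi> x) \<partial>unit_leb)"
      by (rule integral_density) (use g0 in auto)
    finally have "(\<integral>x. w x \<partial>N) = (\<integral>x. w (\<phi> x) * g x \<partial>unit_leb)" by (simp add: mult.commute)
    moreover have "(\<integral>x. w x \<partial>N) = (\<integral>x. k x *\<^sub>R w x \<partial>unit_leb)"
      unfolding Nk by (rule integral_density) (use k0 in auto)
    ultimately show "(\<integral>x. w (\<phi> x) * g x \<partial>unit_leb) = (\<integral>x. w x * k x \<partial>unit_leb)"
      by (simp add: mult.commute)
  qed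
qed

lemma pushes_to_lincomb:
  assumes g: "pushes_to g k" and g': "pushes_to g' k'"
  shows "pushes_to (\<lambda>x. a * g x + b * g' x) (\<lambda>x. a * k x + b * k' x)"
  unfolding pushes_to_def
proof (intro conjI ballI allI impI)
  note D = pushes_toD[OF g] and D' = pushes_toD[OF g']
  show "integrable unit_leb (\<lambda>x. a * g x + b * g' x)" "integrable unit_leb (\<lambda>x. a * k x + b * k' x)"
    using D D' by auto
  fix w :: "real \<Rightarrow> real" and B assume w[measurable]: "w \<in> borel_measurable unit_leb"
    and B: "\<forall>x. \<bar>w x\<bar> \<le> B"
  have w\<phi>: "(\<lambda>x. w (\<phi> x)) \<in> borel_measurable unit_leb" by measurable
  have "(\<integral>x. w (\<phi> x) * (a * g x + b * g' x) \<partial>unit_leb)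
      = (\<integral>x. a * (w (\<phi> x) * g x) + b * (w (\<phi> x) * g' x) \<partial>unit_leb)"
    by (simp add: algebra_simps)
  also have "\<dots> = a * (\<integral>x. w (\<phi> x) * g x \<partial>unit_leb) + b * (\<integral>x. w (\<phi> x) * g' x \<partial>unit_leb)"
    using integrable_bounded_mult[OF D(1) w\<phi>, of B] integrable_bounded_mult[OF D'(1) w\<phi>, of B] B by simp
  also have "\<dots> = a * (\<integral>x. w x * k x \<partial>unit_leb) + b * (\<integral>x. w x * k' x \<partial>unit_leb)"
    using D(3)[OF w, of B] D'(3)[OF w, of B] B by simp
  also have "\<dots> = (\<integral>x. a * (w x * k x) + b * (w x * k' x) \<partial>unit_leb)"
    using integrable_bounded_mult[OF D(2) w, of B] integrable_bounded_mult[OF D'(2) w, of B] B by simp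
  finally show "(\<integral>x. w (\<phi> x) * (a * g x + b * g' x) \<partial>unit_leb)
      = (\<integral>x. w x * (a * k x + b * k' x) \<partial>unit_leb)"
    by (simp add: algebra_simps)
qed

lemma pushes_to_exists:
  assumes g: "integrable unit_leb g"
  shows "\<exists>k. pushes_to g k"
proof -
  obtain k k' where "pushes_to (\<lambda>x. max 0 (g x)) k" "pushes_to (\<lambda>x. max 0 (- g x)) k'"
    using pushes_to_nonneg_exists[of "\<lambda>x. max 0 (g x)"]
      pushes_to_nonneg_exists[of "\<lambda>x. max 0 (- g x)"] g by auto
  from pushes_to_lincomb[OF this, of 1 "- 1"]
  have "pushes_to (\<lambda>x. max 0 (g x) - max 0 (- g x)) (\<lambda>x. k x - k' x)" by simp
  also have "(\<lambda>x. max 0 (g x) - max 0 (- g x)) = g" by (auto simp: max_def)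
  finally show ?thesis by blast
qed

lemma pushes_to_unique:
  assumes g: "pushes_to g k" and g': "pushes_to g' k'" and eq: "AE x in unit_leb. g x = g' x"
  shows "AE x in unit_leb. k x = k' x"
proof (rule integral_sgn_eq_imp_AE)
  note D = pushes_toD[OF g] and D' = pushes_toD[OF g']
  note [measurable] = D(1,2)[THEN borel_measurable_integrable] D'(1,2)[THEN borel_measurable_integrable]
  show "integrable unit_leb k" "integrable unit_leb k'" by (rule D(2), rule D'(2))
  let ?w = "\<lambda>x. sgn (k x - k' x)"
  have w: "?w \<in> borel_measurable unit_leb" "\<bar>?w x\<bar> \<le> 1" for x
    by (simp_all add: abs_sgn_eq)
  have "(\<integral>x. ?w x * k x \<partial>unit_leb) = (\<integral>x. ?w (\<phi> x) * g x \<partial>unit_leb)" by (rule D(3)[OF w, symmetric])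
  also have "\<dots> = (\<integral>x. ?w (\<phi> x) * g' x \<partial>unit_leb)"
    by (rule integral_cong_AE) (use eq in \<open>auto elim: eventually_mono\<close>)
  also have "\<dots> = (\<integral>x. ?w x * k' x \<partial>unit_leb)" by (rule D'(3)[OF w])
  finally show "(\<integral>x. ?w x * k x \<partial>unit_leb) = (\<integral>x. ?w x * k' x \<partial>unit_leb)" .
qed

definition push :: "L0 \<Rightarrow> real \<Rightarrow> real" where "push g = (SOME k. pushes_to (fn g) k)"

lemma pushes_to_push: "integrable unit_leb (fn g) \<Longrightarrow> pushes_to (fn g) (push g)"
  unfolding push_def by (rule someI_ex[OF pushes_to_exists])

text \<open>The quotient \<open>push g / u\<close> is the conditional expectation of \<open>g\<close> given \<open>\<phi>\<close>, as a function of
  the value of \<open>\<phi>\<close>; it is \<open>0\<close> where \<open>u\<close> vanishes.\<close>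

definition weighted_cond_exp :: "L0 \<Rightarrow> L0" where "weighted_cond_exp g = abs_L0 (\<lambda>x. weight x * (push g x / u x))"

lemma push_measurable: "integrable unit_leb (fn g) \<Longrightarrow> push g \<in> borel_measurable unit_leb"
  using pushes_toD(2)[OF pushes_to_push] by (rule borel_measurable_integrable)

lemma fn_weighted_cond_exp:
  assumes "integrable unit_leb (fn g)"
  shows "AE x in unit_leb. fn (weighted_cond_exp g) x = weight x * (push g x / u x)"
  unfolding weighted_cond_exp_def
proof (rule fn_abs)
  note [measurable] = push_measurable[OF assms]
  show "(\<lambda>x. weight x * (push g x / u x)) \<in> borel_measurable unit_leb" by measurable
qed

lemma weighted_cond_exp_lincomb:
  assumes f: "integrable unit_leb (fn f)" and g: "integrable unit_leb (fn g)"
  shows "weighted_cond_exp (a *\<^sub>R f + b *\<^sub>R g) = a *\<^sub>R weighted_cond_exp f + b *\<^sub>R weighted_cond_exp g"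
proof (rule fn_eqI)
  have e: "AE x in unit_leb. fn (a *\<^sub>R f + b *\<^sub>R g) x = a * fn f x + b * fn g x"
    using fn_plus[of "a *\<^sub>R f" "b *\<^sub>R g"] fn_scaleR[of a f] fn_scaleR[of b g] by eventually_elim simp
  have i: "integrable unit_leb (fn (a *\<^sub>R f + b *\<^sub>R g))"
    using integrable_cong_AE[OF _ _ e] f g by simp
  have "AE x in unit_leb. push (a *\<^sub>R f + b *\<^sub>R g) x = a * push f x + b * push g x"
    by (rule pushes_to_unique[OF pushes_to_push[OF i] _ e])
      (rule pushes_to_lincomb[OF pushes_to_push[OF f] pushes_to_push[OF g]])
  then show "AE x in unit_leb. fn (weighted_cond_exp (a *\<^sub>R f + b *\<^sub>R g)) x = fn (a *\<^sub>R weighted_cond_exp f + b *\<^sub>R weighted_cond_exp g) x"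
    using fn_weighted_cond_exp[OF i] fn_weighted_cond_exp[OF f] fn_weighted_cond_exp[OF g] fn_plus[of "a *\<^sub>R weighted_cond_exp f" "b *\<^sub>R weighted_cond_exp g"]
      fn_scaleR[of a "weighted_cond_exp f"] fn_scaleR[of b "weighted_cond_exp g"]
    by eventually_elim (simp add: algebra_simps add_divide_distrib)
qed

text \<open>Integrate \<open>abs_powr_tangent_le\<close> with \<open>a = h \<circ> \<phi>\<close> and \<open>b = g\<close>. The linear term \<open>b n \<circ> \<phi> * (g - h \<circ> \<phi>)\<close>
  vanishes, because the slope \<open>b n\<close> is evaluated at \<open>\<phi>\<close> and \<open>h \<circ> \<phi>\<close> is the conditional expectation of \<open>g\<close>.
  Only bounded slopes can be tested, whence the truncation to the sets \<open>A n\<close>, which increase to the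
  whole interval.\<close>

lemma modular_weighted_cond_exp_le:
  assumes g: "g \<in> Lvar (r \<circ> \<phi>)"
  shows "modular r (weighted_cond_exp g) \<le> modular (r \<circ> \<phi>) g"
proof -
  have ig: "integrable unit_leb (fn g)" by (rule Lvar_integrable[OF comp_exponent g])
  note [measurable] = push_measurable[OF ig]
  define h where "h x = push g x / u x" for x
  have [measurable]: "h \<in> borel_measurable unit_leb" unfolding h_def by measurable
  have "modular (r \<circ> \<phi>) g < \<infinity>"
    using Lvar_imp_modular_finite[OF comp_exponent, of R] AE_nonsingular[OF ns R] g by simp
  then have ip: "integrable unit_leb (\<lambda>x. \<bar>fn g x\<bar> powr r (\<phi> x))"
    unfolding modular_fn by (intro integrableI_nonneg) auto
  define A where "A n = {x \<in> space unit_leb. \<bar>h x\<bar> \<le> real n \<and> r x \<le> real n}" for n :: nat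
  have A[measurable]: "A n \<in> sets unit_leb" for n unfolding A_def by measurable
  define a where "a n x = indicator (A n) x * \<bar>h x\<bar> powr r x" for n x
  define b where "b n x = indicator (A n) x * (r x * \<bar>h x\<bar> powr (r x - 1) * sgn (h x))" for n x
  have [measurable]: "a n \<in> borel_measurable unit_leb" "b n \<in> borel_measurable unit_leb" for n
    unfolding a_def b_def by measurable
  define B where "B n = max 1 (real n) powr real n" for n :: nat
  have powB: "\<bar>h x\<bar> powr p \<le> B n" if "x \<in> A n" "0 \<le> p" "p \<le> real n" for n x p
  proof -
    have "\<bar>h x\<bar> powr p \<le> max 1 (real n) powr p"
      using that by (intro powr_mono2) (auto simp: A_def)
    also have "\<dots> \<le> B n" unfolding B_def using that by (intro powr_mono) auto
    finally show ?thesis .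
  qed
  have B0: "0 \<le> B n" for n by (simp add: B_def)
  have aB: "\<bar>a n x\<bar> \<le> B n" for n x
    using powB[of x n "r x"] r_ge_1[of x] B0[of n] by (auto simp: a_def indicator_def A_def)
  have bB: "\<bar>b n x\<bar> \<le> real n * B n" for n x
  proof (cases "x \<in> A n")
    case True
    have x: "x \<in> {0..1}" "r x \<le> real n" using True by (auto simp: A_def)
    have "\<bar>b n x\<bar> \<le> r x * \<bar>h x\<bar> powr (r x - 1)"
      using True r_ge_1[OF x(1)] by (simp add: b_def abs_mult abs_sgn_eq)
    also have "\<dots> \<le> real n * B n"
      using x r_ge_1[OF x(1)] powB[OF True, of "r x - 1"] by (intro mult_mono) auto
    finally show ?thesis .
  qed (use B0 in \<open>simp add: b_def\<close>)
  have le: "(\<integral>x. a n (\<phi> x) \<partial>unit_leb) \<le> (\<integral>x. \<bar>fn g x\<bar> powr r (\<phi> x) \<partial>unit_leb)" for n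
  proof -
    have ia: "integrable unit_leb (\<lambda>x. a n (\<phi> x))"
      by (rule leb.integrable_const_bound[of _ "B n"]) (use aB in auto)
    have ibg: "integrable unit_leb (\<lambda>x. b n (\<phi> x) * fn g x)"
      by (rule integrable_bounded_mult[OF ig _ bB]) measurable
    have bhB: "\<bar>b n x * h x\<bar> \<le> real n * B n * real n" for x
    proof (cases "x \<in> A n")
      case True
      then show ?thesis
        using bB[of n x] unfolding abs_mult by (intro mult_mono) (auto simp: A_def)
    qed (use B0 in \<open>simp add: b_def\<close>)
    have ibh: "integrable unit_leb (\<lambda>x. b n (\<phi> x) * h (\<phi> x))"
      by (rule leb.integrable_const_bound[of _ "real n * B n * real n"]) (use bhB in auto)
    have "(\<integral>x. b n (\<phi> x) * fn g x \<partial>unit_leb) = (\<integral>x. b n x * push g x \<partial>unit_leb)"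
      by (rule pushes_toD(3)[OF pushes_to_push[OF ig] _ bB]) measurable
    \<comment> \<open>Where \<open>u\<close> vanishes, division by zero makes \<open>h\<close> and \<open>b n\<close> vanish as well, whatever the value of
      \<open>push g\<close> is.\<close>
    also have "\<dots> = (\<integral>x. u x * (b n x * h x) \<partial>unit_leb)"
      by (rule Bochner_Integration.integral_cong) (auto simp: h_def b_def)
    also have "\<dots> = (\<integral>x. b n (\<phi> x) * h (\<phi> x) \<partial>unit_leb)"
      by (rule integral_comp[symmetric]) measurable
    finally have eq: "(\<integral>x. b n (\<phi> x) * fn g x \<partial>unit_leb) = (\<integral>x. b n (\<phi> x) * h (\<phi> x) \<partial>unit_leb)" .
    have pw: "AE x in unit_leb.
        a n (\<phi> x) + b n (\<phi> x) * fn g x - b n (\<phi> x) * h (\<phi> x) \<le> \<bar>fn g x\<bar> powr r (\<phi> x)"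
      using AE_nonsingular[OF ns AE_unit]
    proof eventually_elim
      fix x assume "\<phi> x \<in> {0..1}"
      from abs_powr_tangent_le[OF r_ge_1[OF this], of "h (\<phi> x)" "fn g x"]
      show "a n (\<phi> x) + b n (\<phi> x) * fn g x - b n (\<phi> x) * h (\<phi> x) \<le> \<bar>fn g x\<bar> powr r (\<phi> x)"
        by (auto simp: a_def b_def indicator_def algebra_simps)
    qed
    have "(\<integral>x. a n (\<phi> x) \<partial>unit_leb)
        = (\<integral>x. a n (\<phi> x) + b n (\<phi> x) * fn g x - b n (\<phi> x) * h (\<phi> x) \<partial>unit_leb)"
      using ia ibg ibh eq by simp
    also have "\<dots> \<le> (\<integral>x. \<bar>fn g x\<bar> powr r (\<phi> x) \<partial>unit_leb)"
      by (rule integral_mono_AE[OF _ ip pw]) (use ia ibg ibh in auto)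
    finally show ?thesis .
  qed
  have nn: "(\<integral>\<^sup>+ x. ennreal (u x) * ennreal (a n x) \<partial>unit_leb) \<le> modular (r \<circ> \<phi>) g" for n
  proof -
    have ia: "integrable unit_leb (\<lambda>x. a n (\<phi> x))"
      by (rule leb.integrable_const_bound[of _ "B n"]) (use aB in auto)
    have "(\<integral>\<^sup>+ x. ennreal (u x) * ennreal (a n x) \<partial>unit_leb) = (\<integral>\<^sup>+ x. ennreal (a n (\<phi> x)) \<partial>unit_leb)"
      by (rule nn_integral_comp[symmetric]) measurable
    also have "\<dots> = ennreal (\<integral>x. a n (\<phi> x) \<partial>unit_leb)"
      by (rule nn_integral_eq_integral[OF ia]) (simp add: a_def)
    also have "\<dots> \<le> ennreal (\<integral>x. \<bar>fn g x\<bar> powr r (\<phi> x) \<partial>unit_leb)" by (rule ennreal_leI[OF le])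
    also have "\<dots> = modular (r \<circ> \<phi>) g"
      unfolding modular_fn using nn_integral_eq_integral[OF ip] by simp
    finally show ?thesis .
  qed
  have mono: "a m x \<le> a n x" if "m \<le> n" for m n x
    using that by (auto simp: a_def indicator_def A_def)
  have sup: "ennreal (u x) * ennreal (\<bar>h x\<bar> powr r x) = (SUP n. ennreal (u x) * ennreal (a n x))"
    if x: "x \<in> space unit_leb" for x
  proof (rule antisym)
    obtain n where "max \<bar>h x\<bar> (r x) \<le> real n" using real_arch_simple by blast
    then have "x \<in> A n" using x by (simp add: A_def)
    then have "ennreal (u x) * ennreal (\<bar>h x\<bar> powr r x) = ennreal (u x) * ennreal (a n x)"
      by (simp add: a_def)
    also have "\<dots> \<le> (SUP n. ennreal (u x) * ennreal (a n x))" by (rule SUP_upper) simp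
    finally show "ennreal (u x) * ennreal (\<bar>h x\<bar> powr r x) \<le> (SUP n. ennreal (u x) * ennreal (a n x))" .
    show "(SUP n. ennreal (u x) * ennreal (a n x)) \<le> ennreal (u x) * ennreal (\<bar>h x\<bar> powr r x)"
      by (rule SUP_least, rule mult_left_mono) (auto simp: a_def indicator_def)
  qed
  have "modular r (weighted_cond_exp g) = (\<integral>\<^sup>+ x. ennreal (u x) * ennreal (\<bar>h x\<bar> powr r x) \<partial>unit_leb)"
    unfolding modular_fn
  proof (rule nn_integral_cong_AE)
    show "AE x in unit_leb. ennreal (\<bar>fn (weighted_cond_exp g) x\<bar> powr r x) = ennreal (u x) * ennreal (\<bar>h x\<bar> powr r x)"
      using AE_unit fn_weighted_cond_exp[OF ig]
    proof eventually_elim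
      fix x assume x: "x \<in> {0..1}" "fn (weighted_cond_exp g) x = weight x * (push g x / u x)"
      then show "ennreal (\<bar>fn (weighted_cond_exp g) x\<bar> powr r x) = ennreal (u x) * ennreal (\<bar>h x\<bar> powr r x)"
        using weight_powr[OF x(1)] u_nonneg[OF x(1)]
        by (simp only: x(2) abs_mult powr_mult flip: h_def) (simp add: ennreal_mult)
    qed
  qed
  also have "\<dots> = (\<integral>\<^sup>+ x. (SUP n. ennreal (u x) * ennreal (a n x)) \<partial>unit_leb)"
    by (rule nn_integral_cong) (rule sup)
  also have "\<dots> = (SUP n. \<integral>\<^sup>+ x. ennreal (u x) * ennreal (a n x) \<partial>unit_leb)"
    by (rule nn_integral_monotone_convergence_SUP)
      (auto simp: incseq_def le_fun_def intro!: mult_left_mono ennreal_leI mono)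
  also have "\<dots> \<le> modular (r \<circ> \<phi>) g" by (rule SUP_least) (rule nn)
  finally show ?thesis .
qed

lemma modular_bounded_weighted_cond_exp: "modular_bounded (r \<circ> \<phi>) r weighted_cond_exp"
  unfolding modular_bounded_def
proof (intro conjI ballI allI exI[of _ 1])
  fix f g assume f: "f \<in> Lvar (r \<circ> \<phi>)"
  note i = Lvar_integrable[OF comp_exponent]
  show "weighted_cond_exp (f + g) = weighted_cond_exp f + weighted_cond_exp g" if g: "g \<in> Lvar (r \<circ> \<phi>)"
    using weighted_cond_exp_lincomb[OF i[OF f] i[OF g], of 1 1] by simp
  show "weighted_cond_exp (c *\<^sub>R f) = c *\<^sub>R weighted_cond_exp f" for c
    using weighted_cond_exp_lincomb[OF i[OF f] i[OF f], of c 0] by simp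
  show "modular r (weighted_cond_exp f) \<le> ennreal 1 * modular (r \<circ> \<phi>) f"
    using modular_weighted_cond_exp_le[OF f] by simp
qed

text \<open>The image of the measure with density \<open>f \<circ> \<phi>\<close> has density \<open>u * f\<close>, so \<open>h = f\<close> wherever \<open>u > 0\<close>.\<close>

lemma weighted_cond_exp_comp_op:
  assumes f: "f \<in> Lvar r"
  shows "weighted_cond_exp (comp_op \<phi> f) = mult_op weight f"
proof (rule fn_eqI)
  have ic: "integrable unit_leb (fn (comp_op \<phi> f))"
    using maps f by (intro Lvar_integrable[OF comp_exponent]) auto
  then have "integrable unit_leb (\<lambda>x. fn f (\<phi> x))"
    using integrable_cong_AE[OF _ _ fn_comp_op[OF ns, of f]] by simp
  then have iu: "integrable unit_leb (\<lambda>x. u x * fn f x)" by (simp add: integrable_comp_iff)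
  have "pushes_to (fn (comp_op \<phi> f)) (\<lambda>x. u x * fn f x)"
    unfolding pushes_to_def
  proof (intro conjI ballI allI impI ic iu)
    fix w :: "real \<Rightarrow> real" and B assume w[measurable]: "w \<in> borel_measurable unit_leb"
    have "(\<integral>x. w (\<phi> x) * fn (comp_op \<phi> f) x \<partial>unit_leb) = (\<integral>x. w (\<phi> x) * fn f (\<phi> x) \<partial>unit_leb)"
      by (rule integral_cong_AE) (use fn_comp_op[OF ns, of f] in \<open>auto elim: eventually_mono\<close>)
    also have "\<dots> = (\<integral>x. u x * (w x * fn f x) \<partial>unit_leb)" by (rule integral_comp) measurable
    finally show "(\<integral>x. w (\<phi> x) * fn (comp_op \<phi> f) x \<partial>unit_leb) = (\<integral>x. w x * (u x * fn f x) \<partial>unit_leb)"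
      by (simp add: ac_simps)
  qed
  from pushes_to_unique[OF pushes_to_push[OF ic] this]
  have "AE x in unit_leb. push (comp_op \<phi> f) x = u x * fn f x" by simp
  then show "AE x in unit_leb. fn (weighted_cond_exp (comp_op \<phi> f)) x = fn (mult_op weight f) x"
    using fn_weighted_cond_exp[OF ic] fn_mult_op[OF weight_measurable, of f]
    by eventually_elim (auto simp: weight_def)
qed

end

section \<open>Exponents close to one\<close>

text \<open>With the conjugate exponent \<open>q = p / (p - 1)\<close>, the \<open>q\<close>-th power of the weight
  \<open>1 / 2 * m powr (1 / p - 1)\<close> is \<open>(1 / 2) powr q / m\<close>: the factor \<open>m\<close> appears with exponent \<open>- 1\<close> whatever
  \<open>p\<close> is, and the factor \<open>1 / 2\<close> becomes small as \<open>p\<close> approaches \<open>1\<close>. For \<open>m = 0\<close> both fractions are \<open>0\<close>.\<close>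

lemma powr_conjugate_Youngs:
  fixes p m t :: real
  assumes p: "1 < p" and m: "0 \<le> m" and k: "real k \<le> p / (p - 1)"
  shows "\<bar>1 / 2 * m powr (1 / p - 1) * t\<bar> \<le> \<bar>t\<bar> powr p + (1 / 2) ^ k / m"
proof (cases "m = 0")
  case False
  define q where "q = p / (p - 1)"
  define w where "w = 1 / 2 * m powr (1 / p - 1)"
  have q: "q > 1" "1 / p + 1 / q = 1" "(1 / p - 1) * q = - 1"
  proof -
    have "q = 1 + 1 / (p - 1)" unfolding q_def using p by (simp add: field_simps)
    then show "q > 1" using p by simp
    have iq: "1 / q = 1 - 1 / p" unfolding q_def using p by (simp add: field_simps)
    then show "1 / p + 1 / q = 1" by simp
    have "(1 / p - 1) = - (1 / q)" using iq by simp
    then show "(1 / p - 1) * q = - 1" using \<open>q > 1\<close> by simp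
  qed
  have m: "m > 0" using False m by simp
  have w: "0 \<le> w" by (simp add: w_def)
  have "w powr q = (1 / 2) powr q * (m powr (1 / p - 1)) powr q" unfolding w_def by (rule powr_mult)
  also have "\<dots> = (1 / 2) powr q / m"
    unfolding powr_powr q(3) using m by (simp add: powr_minus_divide)
  also have "\<dots> \<le> (1 / 2) powr real k / m"
    using k m by (intro divide_right_mono powr_mono') (auto simp: q_def)
  finally have wq: "w powr q \<le> (1 / 2) ^ k / m" by (simp add: powr_realpow)
  have "\<bar>w * t\<bar> = \<bar>t\<bar> * w" using w by (simp add: abs_mult)
  also have "\<dots> \<le> \<bar>t\<bar> powr p / p + w powr q / q"
    by (rule Youngs_inequality) (use p q w in auto)
  also have "\<dots> \<le> \<bar>t\<bar> powr p / 1 + w powr q / 1"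
    using p q by (intro add_mono divide_left_mono) auto
  also have "\<dots> \<le> \<bar>t\<bar> powr p + (1 / 2) ^ k / m" using wq by simp
  finally show ?thesis unfolding w_def .
qed simp

text \<open>The set \<open>E k\<close> consists of the points at which the conjugate exponent \<open>r / (r - 1)\<close> is larger than \<open>k\<close> and
  at most \<open>k + 1\<close>, and \<open>b k\<close> is supported on \<open>E k\<close>, with modular \<open>1\<close> unless \<open>E k\<close> is null. By the choice of \<open>w\<close>, the function
  \<open>w * b k\<close> is constant on \<open>E k\<close> and has integral \<open>1 / 2\<close>. The functional \<open>f \<mapsto> \<integral> w * f\<close> is bounded, because
  the dominating function \<open>H\<close> has integral at most \<open>(1 / 2) ^ k\<close> over \<open>E k\<close>, which is summable. A weak
  cluster point \<open>f\<close> of the functions \<open>b k\<close> thus satisfies \<open>\<integral> w * f = 1 / 2\<close>. But each functional whose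
  weight is supported on a single \<open>E k\<close> vanishes at all later \<open>b j\<close>, and hence at \<open>f\<close>, so that
  \<open>w * f = 0\<close> almost everywhere.\<close>

lemma unit_ball_not_relatively_weakly_compact:
  assumes r: "r \<in> exponents" and r1: "AE x in unit_leb. 1 < r x"
    and inf1: "\<And>\<epsilon>. 0 < \<epsilon> \<Longrightarrow> \<not> (AE x in unit_leb. 1 + \<epsilon> \<le> r x)"
  shows "\<not> relatively_weakly_compact (Lvar r) (lux_norm r) {f \<in> Lvar r. lux_norm r f \<le> 1}"
proof
  assume rwc: "relatively_weakly_compact (Lvar r) (lux_norm r) {f \<in> Lvar r. lux_norm r f \<le> 1}"
  note [measurable] = exponentsD(1)[OF r]
  define \<kappa> where "\<kappa> x = nat \<lceil>1 / (r x - 1)\<rceil>" for x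
  have [measurable]: "\<kappa> \<in> unit_leb \<rightarrow>\<^sub>M count_space UNIV" unfolding \<kappa>_def by measurable
  define E where "E k = {x \<in> space unit_leb. 1 < r x \<and> \<kappa> x = k}" for k
  have E[measurable]: "E k \<in> sets unit_leb" for k unfolding E_def by measurable
  define m where "m k = measure unit_leb (E k)" for k
  have m0: "0 \<le> m k" for k by (simp add: m_def)
  have emE: "emeasure unit_leb (E k) = ennreal (m k)" for k
    by (simp add: m_def leb.emeasure_eq_measure)
  define w where "w x = 1 / 2 * m (\<kappa> x) powr (1 / r x - 1)" for x
  have w[measurable]: "w \<in> borel_measurable unit_leb" unfolding w_def by measurable
  define H where "H x = (1 / 2) ^ \<kappa> x / m (\<kappa> x)" for x
  have [measurable]: "H \<in> borel_measurable unit_leb" unfolding H_def by measurable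
  have r1E: "AE x in unit_leb. x \<in> E (\<kappa> x)"
    using r1 AE_space[of unit_leb] by eventually_elim (simp add: E_def)
  have intH: "integrable unit_leb H"
  proof (rule integrableI_nonneg)
    show "AE x in unit_leb. 0 \<le> H x" using m0 by (simp add: H_def)
    have "(\<integral>\<^sup>+ x. ennreal (H x) \<partial>unit_leb)
        \<le> (\<integral>\<^sup>+ x. (\<Sum>k. ennreal ((1 / 2) ^ k / m k) * indicator (E k) x) \<partial>unit_leb)"
    proof (rule nn_integral_mono_AE)
      show "AE x in unit_leb. ennreal (H x) \<le> (\<Sum>k. ennreal ((1 / 2) ^ k / m k) * indicator (E k) x)"
        using r1E
      proof eventually_elim
        fix x assume "x \<in> E (\<kappa> x)"
        then have "ennreal (H x) = (\<Sum>k\<in>{\<kappa> x}. ennreal ((1 / 2) ^ k / m k) * indicator (E k) x)"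
          by (simp add: H_def del: sum_mult_indicator)
        also have "\<dots> \<le> (\<Sum>k. ennreal ((1 / 2) ^ k / m k) * indicator (E k) x)"
          by (rule sum_le_suminf) auto
        finally show "ennreal (H x) \<le> (\<Sum>k. ennreal ((1 / 2) ^ k / m k) * indicator (E k) x)" .
      qed
    qed
    also have "\<dots> = (\<Sum>k. \<integral>\<^sup>+ x. ennreal ((1 / 2) ^ k / m k) * indicator (E k) x \<partial>unit_leb)"
      by (rule nn_integral_suminf) simp
    also have "\<dots> \<le> (\<Sum>k. ennreal ((1 / 2) ^ k))"
    proof (rule suminf_le)
      fix k
      have "(\<integral>\<^sup>+ x. ennreal ((1 / 2) ^ k / m k) * indicator (E k) x \<partial>unit_leb)
          = ennreal ((1 / 2) ^ k / m k * m k)"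
        unfolding nn_integral_cmult_indicator[OF E] emE
        by (rule ennreal_mult[symmetric]) (simp_all add: m0)
      also have "\<dots> \<le> ennreal ((1 / 2) ^ k)" by (rule ennreal_leI) simp
      finally show "(\<integral>\<^sup>+ x. ennreal ((1 / 2) ^ k / m k) * indicator (E k) x \<partial>unit_leb)
          \<le> ennreal ((1 / 2) ^ k)" .
    qed auto
    also have "\<dots> = ennreal (\<Sum>k. (1 / 2) ^ k)"
      by (rule suminf_ennreal2) (auto intro: summable_geometric)
    finally show "(\<integral>\<^sup>+ x. ennreal (H x) \<partial>unit_leb) < \<infinity>" by (rule le_less_trans) simp
  qed simp
  have dom: "AE x in unit_leb. \<forall>t. \<bar>c x * w x * t\<bar> \<le> \<bar>t\<bar> powr r x + H x"
    if c: "\<And>x. \<bar>c x\<bar> \<le> 1" for c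
    using r1
  proof eventually_elim
    fix x assume x: "1 < r x"
    have "real (\<kappa> x) \<le> 1 / (r x - 1) + 1" using x by (simp add: \<kappa>_def)
    then have "real (\<kappa> x) \<le> r x / (r x - 1)" using x by (simp add: field_simps)
    from powr_conjugate_Youngs[OF x m0 this]
    have *: "\<bar>w x * t\<bar> \<le> \<bar>t\<bar> powr r x + H x" for t by (simp add: w_def H_def)
    have "\<bar>c x * w x * t\<bar> \<le> 1 * \<bar>w x * t\<bar>" for t
      unfolding mult.assoc[of "c x"] abs_mult[of "c x"] by (rule mult_right_mono[OF c]) simp
    then show "\<forall>t. \<bar>c x * w x * t\<bar> \<le> \<bar>t\<bar> powr r x + H x" using * by (force intro: order_trans)
  qed
  have dual: "(\<lambda>f. \<integral>x. c x * w x * fn f x \<partial>unit_leb) \<in> dual_functionals (Lvar r) (lux_norm r)"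
    and int: "\<And>f. f \<in> Lvar r \<Longrightarrow> integrable unit_leb (\<lambda>x. c x * w x * fn f x)"
    if [measurable]: "c \<in> borel_measurable unit_leb" and c: "\<And>x. \<bar>c x\<bar> \<le> 1" for c
    using integral_dual_functional[OF r _ intH dom[OF c]] by auto
  define b where "b k = abs_L0 (\<lambda>x. indicator (E k) x * m k powr (- 1 / r x))" for k
  have b: "AE x in unit_leb. fn (b k) x = indicator (E k) x * m k powr (- 1 / r x)" for k
    unfolding b_def by (rule fn_abs) measurable
  have mod: "modular r (b k) \<le> 1" if k: "m k > 0" for k
  proof -
    have "modular r (b k) = (\<integral>\<^sup>+ x. ennreal (1 / m k) * indicator (E k) x \<partial>unit_leb)"
      unfolding modular_fn
    proof (rule nn_integral_cong_AE)
      show "AE x in unit_leb. ennreal (\<bar>fn (b k) x\<bar> powr r x) = ennreal (1 / m k) * indicator (E k) x"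
        using b[of k] r1
      proof eventually_elim
        fix x assume x: "fn (b k) x = indicator (E k) x * m k powr (- 1 / r x)" "1 < r x"
        have "- 1 / r x * r x = - 1" using x(2) by simp
        then have "(m k powr (- 1 / r x)) powr r x = 1 / m k"
          using k by (simp only: powr_powr) (simp add: powr_minus_divide)
        then show "ennreal (\<bar>fn (b k) x\<bar> powr r x) = ennreal (1 / m k) * indicator (E k) x"
          unfolding x(1) using x(2) by (cases "x \<in> E k") simp_all
      qed
    qed
    also have "\<dots> = ennreal (1 / m k * m k)"
      using k by (simp add: nn_integral_cmult emE ennreal_mult[symmetric])
    finally show ?thesis using k by simp
  qed
  have bball: "b k \<in> {f \<in> Lvar r. lux_norm r f \<le> 1}" if "m k > 0" for k
    using mod[OF that] lux_norm_le_1[OF mod[OF that]] by (auto intro!: modular_finite_imp_Lvar elim: le_less_trans)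
  have wb: "AE x in unit_leb. w x * fn (b k) x = 1 / (2 * m k) * indicator (E k) x" if k: "m k > 0" for k
    using b[of k]
  proof eventually_elim
    fix x assume x: "fn (b k) x = indicator (E k) x * m k powr (- 1 / r x)"
    show "w x * fn (b k) x = 1 / (2 * m k) * indicator (E k) x"
    proof (cases "x \<in> E k")
      case True
      then have "w x * fn (b k) x = 1 / 2 * (m k powr (1 / r x - 1) * m k powr (- 1 / r x))"
        by (simp add: x w_def E_def)
      also have "\<dots> = 1 / 2 * m k powr (- 1)" by (simp add: powr_add[symmetric])
      finally show ?thesis using True k by (simp add: powr_minus_divide)
    qed (simp add: x)
  qed
  have lb: "(\<integral>x. 1 * w x * fn (b k) x \<partial>unit_leb) = 1 / 2" if k: "m k > 0" for k
  proof -
    have "(\<integral>x. 1 * w x * fn (b k) x \<partial>unit_leb) = (\<integral>x. 1 / (2 * m k) * indicator (E k) x \<partial>unit_leb)"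
      by (rule integral_cong_AE) (use wb[OF k] in auto)
    also have "\<dots> = 1 / (2 * m k) * measure unit_leb (E k \<inter> space unit_leb)" by simp
    also have "E k \<inter> space unit_leb = E k" by (auto simp: E_def)
    finally have "(\<integral>x. 1 * w x * fn (b k) x \<partial>unit_leb) = 1 / (2 * m k) * m k" by (simp add: m_def)
    then show ?thesis using k by simp
  qed
  define F where "F n = b ` {k. n \<le> k \<and> 0 < m k}" for n
  have Fne: "F n \<noteq> {}" for n
  proof
    assume "F n = {}"
    then have "m k = 0" if "n \<le> k" for k using that m0[of k] by (force simp: F_def)
    then have "E k \<in> null_sets unit_leb" if "n \<le> k" for k
      using that by (auto simp: emE)
    then have "AE x in unit_leb. \<forall>k. n \<le> k \<longrightarrow> x \<notin> E k"
      by (auto simp: AE_all_countable intro: AE_not_in)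
    with r1E r1 have "AE x in unit_leb. 1 + 1 / (real n + 1) \<le> r x"
    proof eventually_elim
      fix x assume x: "x \<in> E (\<kappa> x)" "1 < r x" "\<forall>k. n \<le> k \<longrightarrow> x \<notin> E k"
      then have "\<kappa> x < n" by (meson not_le)
      moreover have "1 / (r x - 1) \<le> real (\<kappa> x)"
        unfolding \<kappa>_def by (rule real_nat_ceiling_ge)
      ultimately have "1 / (r x - 1) \<le> real n + 1" by linarith
      then show "1 + 1 / (real n + 1) \<le> r x" using x(2) by (simp add: field_simps)
    qed
    then show False using inf1[of "1 / (real n + 1)"] by simp
  qed
  have Fball: "F n \<subseteq> {f \<in> Lvar r. lux_norm r f \<le> 1}" for n
    using bball by (auto simp: F_def)
  have Fmono: "F n \<subseteq> F k" if "k \<le> n" for k n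
    using that by (auto simp: F_def)
  obtain f where f: "f \<in> Lvar r"
    and cl: "\<And>l n c. l \<in> dual_functionals (Lvar r) (lux_norm r) \<Longrightarrow> \<forall>g\<in>F n. l g = c \<Longrightarrow> l f = c"
  proof (rule relatively_weakly_compact_cluster_point[OF rwc Fne Fball Fmono])
    fix f assume "f \<in> Lvar r"
      and "\<And>l n c. l \<in> dual_functionals (Lvar r) (lux_norm r) \<Longrightarrow> \<forall>g\<in>F n. l g = c \<Longrightarrow> l f = c"
    then show ?thesis by (rule that)
  qed
  have one: "(\<integral>x. 1 * w x * fn f x \<partial>unit_leb) = 1 / 2"
    by (rule cl[OF dual[of "\<lambda>_. 1"], of 0]) (auto simp: F_def lb[simplified])
  have zero: "AE x in unit_leb. x \<in> E k \<longrightarrow> w x * fn f x = 0" for k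
  proof -
    \<comment> \<open>The test weight may depend on \<open>f\<close>; the sign makes the integrand nonnegative.\<close>
    define c where "c x = indicator (E k) x * sgn (fn f x)" for x
    have c[measurable]: "c \<in> borel_measurable unit_leb" unfolding c_def by measurable
    have c1: "\<bar>c x\<bar> \<le> 1" for x by (simp add: c_def abs_mult abs_sgn_eq indicator_def)
    have "(\<integral>x. c x * w x * fn f x \<partial>unit_leb) = 0"
    proof (rule cl[OF dual[OF c c1], of "Suc k"], rule ballI)
      fix g assume "g \<in> F (Suc k)"
      then obtain j where "g = b j" "Suc k \<le> j" by (auto simp: F_def)
      then have j: "g = b j" "k < j" by simp_all
      have "AE x in unit_leb. c x * w x * fn g x = 0"
        using b[of j] by eventually_elim (use j in \<open>auto simp: c_def indicator_def E_def\<close>)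
      then have "(\<integral>x. c x * w x * fn g x \<partial>unit_leb) = (\<integral>x. 0 \<partial>unit_leb)"
        by (intro integral_cong_AE) auto
      then show "(\<integral>x. c x * w x * fn g x \<partial>unit_leb) = 0" by simp
    qed
    moreover have ceq: "c x * w x * fn f x = indicator (E k) x * (w x * \<bar>fn f x\<bar>)" for x
      by (simp add: c_def sgn_if)
    moreover have "AE x in unit_leb. 0 \<le> c x * w x * fn f x"
      unfolding ceq by (simp add: w_def)
    ultimately have "AE x in unit_leb. c x * w x * fn f x = 0"
      using integral_nonneg_eq_0_iff_AE[OF int[OF c c1 f]] by blast
    then show ?thesis unfolding ceq by eventually_elim auto
  qed
  then have "AE x in unit_leb. \<forall>k. x \<in> E k \<longrightarrow> w x * fn f x = 0"
    unfolding AE_all_countable by (rule allI)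
  then have "AE x in unit_leb. w x * fn f x = 0"
    using r1E by eventually_elim blast
  then have "(\<integral>x. 1 * w x * fn f x \<partial>unit_leb) = (\<integral>x. 0 \<partial>unit_leb)"
    by (intro integral_cong_AE) auto
  then show False using one by simp
qed

section \<open>Weak compactness of composition operators\<close>

context composition_setting
begin

lemma comp_op_weakly_compact_iff:
  "weakly_compact_operator (Lvar r) (lux_norm r) (Lvar (r \<circ> \<phi>)) (lux_norm (r \<circ> \<phi>)) (comp_op \<phi>)
    \<longleftrightarrow> weakly_compact_operator (Lvar r) (lux_norm r) (Lvar r) (lux_norm r) (mult_op weight)"
proof
  assume "weakly_compact_operator (Lvar r) (lux_norm r) (Lvar (r \<circ> \<phi>)) (lux_norm (r \<circ> \<phi>)) (comp_op \<phi>)"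
  then show "weakly_compact_operator (Lvar r) (lux_norm r) (Lvar r) (lux_norm r) (mult_op weight)"
    by (rule Lvar_weakly_compact_compose[OF comp_exponent r modular_bounded_weighted_cond_exp]) (rule weighted_cond_exp_comp_op)
next
  assume "weakly_compact_operator (Lvar r) (lux_norm r) (Lvar r) (lux_norm r) (mult_op weight)"
  then show "weakly_compact_operator (Lvar r) (lux_norm r) (Lvar (r \<circ> \<phi>)) (lux_norm (r \<circ> \<phi>)) (comp_op \<phi>)"
    by (rule Lvar_weakly_compact_compose[OF r comp_exponent modular_bounded_weighted_comp]) (rule weighted_comp_mult_op)
qed

text \<open>With \<open>u \<ge> M > 0\<close>, multiplication by \<open>inv_weight\<close> is bounded and undoes multiplication by
  \<open>weight\<close>, so that the identity would be weakly compact.\<close>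

lemma comp_op_not_weakly_compact:
  assumes r1: "AE x in unit_leb. 1 < r x"
    and inf1: "\<And>\<epsilon>. 0 < \<epsilon> \<Longrightarrow> \<not> (AE x in unit_leb. 1 + \<epsilon> \<le> r x)"
    and M: "0 < M" "AE x in unit_leb. M \<le> u x"
  shows "\<not> weakly_compact_operator (Lvar r) (lux_norm r) (Lvar (r \<circ> \<phi>)) (lux_norm (r \<circ> \<phi>)) (comp_op \<phi>)"
proof
  assume "weakly_compact_operator (Lvar r) (lux_norm r) (Lvar (r \<circ> \<phi>)) (lux_norm (r \<circ> \<phi>)) (comp_op \<phi>)"
  then have wc: "weakly_compact_operator (Lvar r) (lux_norm r) (Lvar r) (lux_norm r) (mult_op weight)"
    by (simp add: comp_op_weakly_compact_iff)
  have w: "inv_weight \<in> borel_measurable unit_leb" unfolding inv_weight_def by measurable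
  have "modular r (mult_op inv_weight f) \<le> ennreal (1 / M) * modular r f" for f
  proof -
    have "modular r (mult_op inv_weight f)
        \<le> (\<integral>\<^sup>+ x. ennreal (1 / M) * ennreal (\<bar>fn f x\<bar> powr r x) \<partial>unit_leb)"
      unfolding modular_mult_op[OF w]
    proof (rule nn_integral_mono_AE)
      show "AE x in unit_leb. ennreal (\<bar>inv_weight x\<bar> powr r x) * ennreal (\<bar>fn f x\<bar> powr r x)
          \<le> ennreal (1 / M) * ennreal (\<bar>fn f x\<bar> powr r x)"
        using M(2) r1
      proof eventually_elim
        fix x assume x: "M \<le> u x" "1 < r x"
        have "- 1 / r x * r x = - 1" using x(2) by simp
        then have "inv_weight x powr r x = 1 / u x"
          using x M(1) unfolding inv_weight_def by (simp only: powr_powr) (simp add: powr_minus_divide)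
        then have "\<bar>inv_weight x\<bar> powr r x \<le> 1 / M"
          using x M(1) by (simp add: inv_weight_def frac_le)
        then show "ennreal (\<bar>inv_weight x\<bar> powr r x) * ennreal (\<bar>fn f x\<bar> powr r x)
            \<le> ennreal (1 / M) * ennreal (\<bar>fn f x\<bar> powr r x)"
          by (intro mult_right_mono ennreal_leI) auto
      qed
    qed
    then show ?thesis by (simp add: modular_fn nn_integral_cmult)
  qed
  then have mb: "modular_bounded r r (mult_op inv_weight)"
    unfolding modular_bounded_def using mult_op_plus[OF w] mult_op_scaleR[OF w] by blast
  have id: "mult_op inv_weight (mult_op weight f) = f" for f
  proof (rule fn_eqI)
    show "AE x in unit_leb. fn (mult_op inv_weight (mult_op weight f)) x = fn f x"
      using fn_mult_op[OF w, of "mult_op weight f"] fn_mult_op[OF weight_measurable, of f] M(2)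
      by eventually_elim (use M(1) in \<open>auto simp: weight_def inv_weight_def powr_add[symmetric]\<close>)
  qed
  have "weakly_compact_operator (Lvar r) (lux_norm r) (Lvar r) (lux_norm r) (\<lambda>f. f)"
    by (rule Lvar_weakly_compact_compose[OF r r mb wc id])
  then show False
    using unit_ball_not_relatively_weakly_compact[OF r r1 inf1]
    by (simp add: weakly_compact_operator_def)
qed

end

theorem theorem6:
  fixes r \<phi> u v :: "real \<Rightarrow> real" and \<Omega>\<^sub>1 :: "real set"
  assumes "r \<in> exponents"
    and "esssup unit_leb (\<lambda>x. ereal (r x)) < \<infinity>"
    and "\<Omega>\<^sub>1 = {x \<in> {0..1}. r x = 1}"
    and "emeasure unit_leb \<Omega>\<^sub>1 = 0"
    and "nonsingular \<phi>"
    and "comp_op \<phi> ` Lvar r \<subseteq> Lvar (r \<circ> \<phi>)"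
    and "is_pushforward_density \<phi> u"
    and "v = (\<lambda>x. u x powr (1 / r x))"
  shows "(\<forall>A. relatively_weakly_compact (Lvar r) (lux_norm r) A \<longrightarrow>
           relatively_weakly_compact (Lvar (r \<circ> \<phi>)) (lux_norm (r \<circ> \<phi>)) (comp_op \<phi> ` A))
    \<and> (mult_op v ` Lvar r \<subseteq> Lvar r \<and>
        (weakly_compact_operator (Lvar r) (lux_norm r) (Lvar (r \<circ> \<phi>)) (lux_norm (r \<circ> \<phi>)) (comp_op \<phi>)
          \<longleftrightarrow> weakly_compact_operator (Lvar r) (lux_norm r) (Lvar r) (lux_norm r) (mult_op v)))
    \<and> (essinf unit_leb (\<lambda>x. ereal (r x)) = 1 \<longrightarrow> (INF z\<in>{0..1} - \<Omega>\<^sub>1. u z) > 0 \<longrightarrow>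
        \<not> weakly_compact_operator (Lvar r) (lux_norm r) (Lvar (r \<circ> \<phi>)) (lux_norm (r \<circ> \<phi>)) (comp_op \<phi>))"
proof -
  obtain R where R: "AE x in unit_leb. r x \<le> R"
  proof (cases "esssup unit_leb (\<lambda>x. ereal (r x))")
    case (real R)
    then show ?thesis
      using that[of R] esssup_AE[of "\<lambda>x. ereal (r x)" unit_leb] by simp
  next
    case MInf
    then have "AE x in unit_leb. False"
      using esssup_AE[of "\<lambda>x. ereal (r x)" unit_leb] by simp
    then have "AE x in unit_leb. r x \<le> 0" by eventually_elim simp
    then show ?thesis by (rule that)
  qed (use assms(2) in simp)
  interpret composition_setting r \<phi> u R
    using assms R by unfold_locales
  have v: "v = composition_setting.weight r u"
    unfolding assms(8) by (simp add: weight_def fun_eq_iff)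
  have \<Omega>\<^sub>1: "\<Omega>\<^sub>1 = {x \<in> space unit_leb. r x = 1}" using assms(3) by simp
  have "\<Omega>\<^sub>1 \<in> sets unit_leb" unfolding \<Omega>\<^sub>1 by measurable
  then have "AE x in unit_leb. x \<notin> \<Omega>\<^sub>1" using assms(4) by (intro AE_not_in null_setsI)
  then have notin: "AE x in unit_leb. x \<in> {0..1} - \<Omega>\<^sub>1"
    using AE_unit by eventually_elim simp
  then have r1: "AE x in unit_leb. 1 < r x"
    by eventually_elim (use r_ge_1 in \<open>force simp: assms(3) order_less_le\<close>)
  have "\<not> weakly_compact_operator (Lvar r) (lux_norm r) (Lvar (r \<circ> \<phi>)) (lux_norm (r \<circ> \<phi>)) (comp_op \<phi>)"
    if inf: "essinf unit_leb (\<lambda>x. ereal (r x)) = 1" and M: "(INF z\<in>{0..1} - \<Omega>\<^sub>1. u z) > 0"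
  proof (rule comp_op_not_weakly_compact[OF r1 _ M])
    fix \<epsilon> :: real assume \<epsilon>: "0 < \<epsilon>"
    show "\<not> (AE x in unit_leb. 1 + \<epsilon> \<le> r x)"
    proof
      assume "AE x in unit_leb. 1 + \<epsilon> \<le> r x"
      then have "ereal (1 + \<epsilon>) \<le> essinf unit_leb (\<lambda>x. ereal (r x))"
        unfolding essinf_def by (intro Sup_upper) simp
      then show False using \<epsilon> unfolding inf by (simp add: one_ereal_def)
    qed
  next
    have bdd: "bdd_below (u ` ({0..1} - \<Omega>\<^sub>1))"
      by (rule bdd_belowI[of _ 0]) (use u_nonneg in auto)
    show "AE x in unit_leb. (INF z\<in>{0..1} - \<Omega>\<^sub>1. u z) \<le> u x"
      using notin by eventually_elim (rule cINF_lower[OF bdd])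
  qed
  then show ?thesis
    using Lvar_relatively_weakly_compact_image[OF r comp_exponent modular_bounded_comp_op]
      mult_op_weight_maps comp_op_weakly_compact_iff unfolding v by blast
qed

end
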